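(* Let $n\ge2$ and let $q$ be a prime power. Each of the $m$-covers $\mathcal F,\mathcal O_1,\mathcal O_2$ of $\mathcal W(4n-1,q)$ is $(4n-3)$-dual of symplectic type.
   Context: $\theta_{n,q}=q^n+\dots+q+1$ for $n\ge0$, $\theta_{-1,q}=0$. Setting. Let $V=\mathbb F_{q^2}^{2n}$ with a nondegenerate alternating $\mathbb F_{q^2}$-bilinear form $f$, and regard $V$ as a $4n$-dimensional $\mathbb F_q$-space, so that $\Sigma=\mathrm{PG}(V)=\mathrm{PG}(4n-1,q)$. For $\lambda\in\mathbb F_{q^2}^*$ the form $b_\lambda(x,y)=\mathrm{Tr}_{\mathbb F_{q^2}/\mathbb F_q}(\lambda f(x,y))$ is a nondegenerate alternating $\mathbb F_q$-form on $V$; up to $\mathbb F_q^*$-multiples this gives $q+1$ symplectic polar spaces (linear complexes) of $\Sigma$, a pencil stabilised by the group $G\simeq\mathrm{PSp}(2n,q^2)$ induced by the isometries of $f$. $\mathcal W(4n-1,q)$ is one of them, with polarity $\perp$. Its lines are the totally isotropic lines. $\mathcal F$ is the line spread of $\Sigma$ (constructed by Dye) whose members are the $1$-dimensional $\mathbb F_{q^2}$-subspaces of $V$, viewed as lines of $\Sigma$; all are lines of $\mathcal W(4n-1,q)$. Call a line $\ell$ conjugate to a line $r$ if $\ell\subseteq r^\perp$. $\mathcal O_1$ is the set of lines of $\mathcal W(4n-1,q)$ not in $\mathcal F$ that are not conjugate to the members of $\mathcal F$ that they meet non-trivially; $\mathcal O_2$ is the set of lines of $\mathcal W(4n-1,q)$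 not in $\mathcal F$ that are conjugate to each member of $\mathcal F$ that they meet non-trivially. The sets $\mathcal F,\mathcal O_1,\mathcal O_2$ are the three $G$-orbits on the lines of $\mathcal W(4n-1,q)$. An $m$-cover of $\mathcal W(r,q)$ ($r$ odd, $m>0$) is a set of lines of $\mathcal W(r,q)$ such that every point of $\mathrm{PG}(r,q)$ lies on exactly $m$ of them. Each of $\mathcal F,\mathcal O_1,\mathcal O_2$ is an $m$-cover for its own value of $m$ (because $G$ is transitive on points of $\Sigma$). An $m$-cover $\mathcal L$ of $\mathcal W(r,q)$ is $(r-2)$-dual of symplectic type if for every line $\ell$ of $\mathrm{PG}(r,q)$ the number of lines of $\mathcal L$ contained in $\ell^\perp$ equals $\frac{m\theta_{r-4,q}}{q+1}+q^{r-3}$ if $\ell\in\mathcal L$, and $\frac{m\theta_{r-4,q}}{q+1}$ if $\ell\notin\mathcal L$. *)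

theory Defs
  imports
    "HOL-Analysis.Cartesian_Space"
    "HOL-Number_Theory.Prime_Powers"
    "HOL-Computational_Algebra.Primes"
    "HOL-Computational_Algebra.Polynomial"
begin

text \<open>
  A vector space is given by its scalar multiplication \<open>smul :: 'k \<Rightarrow> 'v \<Rightarrow> 'v\<close>; its underlying set
  is the whole type. Points and lines of \<open>PG(V)\<close> are identified with the subspaces of vector space
  dimension 1 and 2, so incidence is inclusion and ``to meet non-trivially'' means to
  share a nonzero vector.
\<close>

definition pg_points :: "('k::field \<Rightarrow> 'v::ab_group_add \<Rightarrow> 'v) \<Rightarrow> 'v set set" where
  "pg_points smul = {P. module.subspace smul P \<and> vector_space.dim smul P = 1}"

definition pg_lines :: "('k::field \<Rightarrow> 'v::ab_group_add \<Rightarrow> 'v) \<Rightarrow> 'v set set" where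
  "pg_lines smul = {l. module.subspace smul l \<and> vector_space.dim smul l = 2}"

definition symplectic_form ::
  "('k::field \<Rightarrow> 'v::ab_group_add \<Rightarrow> 'v) \<Rightarrow> ('v \<Rightarrow> 'v \<Rightarrow> 'k) \<Rightarrow> bool" where
  "symplectic_form smul b \<longleftrightarrow>
     (\<forall>x. Vector_Spaces.linear smul (*) (\<lambda>y. b x y)) \<and>
     (\<forall>y. Vector_Spaces.linear smul (*) (\<lambda>x. b x y)) \<and>
     (\<forall>x. b x x = 0) \<and>
     (\<forall>x. (\<forall>y. b x y = 0) \<longrightarrow> x = 0)"

definition perp :: "('v \<Rightarrow> 'v \<Rightarrow> 'k::zero) \<Rightarrow> 'v set \<Rightarrow> 'v set" where
  "perp b S = {y. \<forall>x\<in>S. b x y = 0}"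

text \<open>For a symplectic form \<open>b\<close> on a space of dimension \<open>r + 1\<close> these are the lines of \<open>W(r,q)\<close>.\<close>

definition polar_lines ::
  "('k::field \<Rightarrow> 'v::ab_group_add \<Rightarrow> 'v) \<Rightarrow> ('v \<Rightarrow> 'v \<Rightarrow> 'k) \<Rightarrow> 'v set set" where
  "polar_lines smul b = {l \<in> pg_lines smul. l \<subseteq> perp b l}"

definition conjugate :: "('v \<Rightarrow> 'v \<Rightarrow> 'k::zero) \<Rightarrow> 'v set \<Rightarrow> 'v set \<Rightarrow> bool" where
  "conjugate b l r \<longleftrightarrow> l \<subseteq> perp b r"

definition m_cover ::
  "('k::field \<Rightarrow> 'v::ab_group_add \<Rightarrow> 'v) \<Rightarrow> ('v \<Rightarrow> 'v \<Rightarrow> 'k) \<Rightarrow> nat \<Rightarrow> 'v set set \<Rightarrow> bool" where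
  "m_cover smul b m L \<longleftrightarrow>
     m > 0 \<and> L \<subseteq> polar_lines smul b \<and>
     (\<forall>P\<in>pg_points smul. card {l \<in> L. P \<subseteq> l} = m)"

text \<open>\<open>theta k q = q ^ k + \<dots> + q + 1\<close> for \<open>k \<ge> 0\<close>; the index is an integer so that
  \<open>theta (-1) q = 0\<close>.\<close>

definition theta :: "int \<Rightarrow> nat \<Rightarrow> nat" where
  "theta k q = (\<Sum>i<nat (k + 1). q ^ i)"

text \<open>
  The parameter \<open>d\<close> is \<open>r - 2\<close>, where \<open>r\<close> is the projective dimension of the ambient space.
  The quotient in the count is a quotient of real numbers, not a truncating division.
\<close>

definition dual_of_symplectic_type ::
  "('k::field \<Rightarrow> 'v::ab_group_add \<Rightarrow> 'v) \<Rightarrow> ('v \<Rightarrow> 'v \<Rightarrow> 'k) \<Rightarrow> nat \<Rightarrow> nat \<Rightarrow> 'v set set \<Rightarrow> bool" where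
  "dual_of_symplectic_type smul b d m L \<longleftrightarrow>
     (let r = d + 2; q = CARD('k) in
       vector_space.dim smul (UNIV :: 'v set) = r + 1 \<and>
       m_cover smul b m L \<and>
       (\<forall>l\<in>pg_lines smul.
          real (card {k \<in> L. k \<subseteq> perp b l}) =
            real m * real (theta (int r - 4) q) / (real q + 1) +
            (if l \<in> L then real q ^ (r - 3) else 0)))"

text \<open>
  The field extension is an embedding \<open>h :: 'k \<Rightarrow> 'a\<close> of fields, where \<open>'k\<close> has order \<open>q\<close> and
  \<open>'a\<close> has order \<open>q^2\<close>.
\<close>

definition field_embedding :: "('k::field \<Rightarrow> 'a::field) \<Rightarrow> bool" where
  "field_embedding h \<longleftrightarrow>
     h 1 = 1 \<and> (\<forall>x y. h (x + y) = h x + h y) \<and> (\<forall>x y. h (x * y) = h x * h y)"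

definition restrict_scale :: "('k::field \<Rightarrow> 'a::field) \<Rightarrow> 'k \<Rightarrow> 'a ^ 'n \<Rightarrow> 'a ^ 'n" where
  "restrict_scale h c v = h c *s v"

text \<open>The relative trace \<open>x \<mapsto> x + x ^ q\<close> of the quadratic extension, pulled back to the small field;
  see \<open>field_trace\<close> below for the proof that \<open>x + x ^ q\<close> is in the range of \<open>h\<close>.\<close>

definition ftrace :: "('k::field \<Rightarrow> 'a::field) \<Rightarrow> 'a \<Rightarrow> 'k" where
  "ftrace h x = inv h (x + x ^ CARD('k))"

definition trace_form ::
  "('k::field \<Rightarrow> 'a::field) \<Rightarrow> ('a ^ 'n \<Rightarrow> 'a ^ 'n \<Rightarrow> 'a) \<Rightarrow> 'a \<Rightarrow> 'a ^ 'n \<Rightarrow> 'a ^ 'n \<Rightarrow> 'k" where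
  "trace_form h f c x y = ftrace h (c * f x y)"

text \<open>Subspaces and dimension over the large field here; each member has dimension 2 for
  \<^term>\<open>restrict_scale h\<close>.\<close>

definition dye_spread :: "('a::field ^ 'n) set set" where
  "dye_spread = {S. vec.subspace S \<and> vec.dim S = 1}"

definition orbit_O1 ::
  "('k::field \<Rightarrow> 'a::field) \<Rightarrow> ('a ^ 'n \<Rightarrow> 'a ^ 'n \<Rightarrow> 'a) \<Rightarrow> 'a \<Rightarrow> ('a ^ 'n) set set" where
  "orbit_O1 h f c =
     {l \<in> polar_lines (restrict_scale h) (trace_form h f c). l \<notin> dye_spread \<and>
        (\<forall>s\<in>dye_spread. l \<inter> s \<noteq> {0} \<longrightarrow> \<not> conjugate (trace_form h f c) l s)}"

definition orbit_O2 ::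
  "('k::field \<Rightarrow> 'a::field) \<Rightarrow> ('a ^ 'n \<Rightarrow> 'a ^ 'n \<Rightarrow> 'a) \<Rightarrow> 'a \<Rightarrow> ('a ^ 'n) set set" where
  "orbit_O2 h f c =
     {l \<in> polar_lines (restrict_scale h) (trace_form h f c). l \<notin> dye_spread \<and>
        (\<forall>s\<in>dye_spread. l \<inter> s \<noteq> {0} \<longrightarrow> conjugate (trace_form h f c) l s)}"

lemma field_embedding_0: "field_embedding h \<Longrightarrow> h 0 = 0"
  unfolding field_embedding_def by (metis add_cancel_right_right)

lemma field_embedding_inj:
  fixes h :: "'k::field \<Rightarrow> 'a::field"
  assumes h: "field_embedding h"
  shows "inj h"
proof (rule injI)
  fix x y assume e: "h x = h y"
  have "h (x - y) + h y = h x"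
    using h unfolding field_embedding_def by (metis diff_add_cancel)
  hence z: "h (x - y) = 0" using e by simp
  show "x = y"
  proof (rule ccontr)
    assume "x \<noteq> y"
    hence "h ((x - y) * inverse (x - y)) = 1" using h by (simp add: field_embedding_def)
    moreover have "h ((x - y) * inverse (x - y)) = 0"
      using h z unfolding field_embedding_def by (metis mult_zero_left)
    ultimately show False by simp
  qed
qed

lemma field_embedding_power: "field_embedding h \<Longrightarrow> h (x ^ k) = h x ^ k"
  by (induction k) (auto simp: field_embedding_def)

lemma vector_space_restrict_scale:
  assumes "field_embedding h"
  shows "vector_space (restrict_scale h)"
  using assms by unfold_locales
    (auto simp: restrict_scale_def field_embedding_def vec.scale_right_distrib vec.scale_left_distrib)

lemma card_power_fixed_le:
  fixes a b :: "'a::field"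
  assumes "2 \<le> k" "a \<noteq> 0"
  shows "finite {x. b * x + a * x ^ k = 0}" "card {x. b * x + a * x ^ k = 0} \<le> k"
proof -
  define p where "p = monom b 1 + monom a k"
  have "coeff p k = a" using assms by (simp add: p_def)
  hence p0: "p \<noteq> 0" using assms by auto
  have dp: "degree p \<le> k"
    unfolding p_def using assms
    by (intro degree_add_le) (auto intro: order_trans[OF degree_monom_le])
  have eq: "{x. b * x + a * x ^ k = 0} = {x. poly p x = 0}"
    by (simp add: p_def poly_monom)
  show "finite {x. b * x + a * x ^ k = 0}" "card {x. b * x + a * x ^ k = 0} \<le> k"
    unfolding eq using poly_roots_finite[OF p0] card_poly_roots_bound[OF p0] dp by auto
qed

lemma card_field_ge_2: "2 \<le> CARD('k::{field,finite})"
proof -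
  have "card {0, 1 :: 'k} \<le> CARD('k)" by (intro card_mono) auto
  thus ?thesis by simp
qed

lemma range_field_embedding:
  fixes h :: "'k::finite_field \<Rightarrow> 'a::field"
  assumes h: "field_embedding h"
  shows "range h = {x. x ^ CARD('k) = x}"
proof -
  have eq: "{x::'a. x ^ CARD('k) = x} = {x. (-1) * x + 1 * x ^ CARD('k) = 0}"
    by (auto simp: algebra_simps)
  have fin: "finite {x::'a. x ^ CARD('k) = x}" "card {x::'a. x ^ CARD('k) = x} \<le> CARD('k)"
    unfolding eq by (rule card_power_fixed_le; use card_field_ge_2[where 'k='k] in simp)+
  have sub: "range h \<subseteq> {x. x ^ CARD('k) = x}"
    using finite_field_power_card_eq_same[where 'a='k]
    by (auto simp flip: field_embedding_power[OF h])
  moreover have "card (range h) = CARD('k)"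
    using field_embedding_inj[OF h] by (simp add: card_image)
  ultimately show ?thesis using fin by (metis card_subset_eq card_mono le_antisym)
qed

lemma card_frobenius_add:
  fixes h :: "'k::finite_field \<Rightarrow> 'a::finite_field" and x y :: 'a
  assumes h: "field_embedding h" and q: "primepow CARD('k)"
  shows "(x + y) ^ CARD('k) = x ^ CARD('k) + y ^ CARD('k)"
proof -
  have "(\<Sum>x\<in>(UNIV::'k set). x + 1) = (\<Sum>x\<in>(UNIV::'k set). x)"
    by (rule sum.reindex_bij_witness[of _ "\<lambda>x. x - 1" "\<lambda>x. x + 1"]) auto
  hence "of_nat CARD('k) = (0::'k)" by (simp add: sum.distrib)
  hence z: "h (of_nat CARD('k)) = 0" using field_embedding_0[OF h] by simp
  have "h (of_nat k) = of_nat k" for k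
    by (induction k) (use h field_embedding_0[OF h] in \<open>auto simp: field_embedding_def\<close>)
  hence "of_nat CARD('k) = (0::'a)" using z by simp
  hence dvd: "CHAR('a) dvd CARD('k)" by (simp only: of_nat_eq_0_iff_char_dvd)
  obtain p k where p: "prime p" and k: "CARD('k) = p ^ k"
    using q unfolding primepow_def by blast
  have "CHAR('a) dvd p" using dvd unfolding k by (rule prime_dvd_power[OF CHAR_prime])
  hence "CHAR('a) = p" using p CHAR_prime[where 'a='a] by (simp add: primes_dvd_imp_eq)
  thus ?thesis unfolding k by (intro freshmans_dream') auto
qed

lemma field_trace:
  fixes h :: "'k::finite_field \<Rightarrow> 'a::finite_field"
  assumes h: "field_embedding h" and q: "primepow CARD('k)" and a: "CARD('a) = CARD('k) ^ 2"
  shows "h (ftrace h x) = x + x ^ CARD('k)"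
proof -
  have "(x + x ^ CARD('k)) ^ CARD('k) = x ^ CARD('k) + x ^ (CARD('k) ^ 2)"
    by (simp add: card_frobenius_add[OF h q] power2_eq_square flip: power_mult)
  also have "x ^ (CARD('k) ^ 2) = x"
    using finite_field_power_card_eq_same[of x] by (simp add: a)
  finally have "x + x ^ CARD('k) \<in> range h"
    unfolding range_field_embedding[OF h] by (simp add: add.commute)
  thus ?thesis unfolding ftrace_def by (rule f_inv_into_f)
qed

lemma field_trace_nonzero:
  fixes h :: "'k::finite_field \<Rightarrow> 'a::finite_field"
  assumes h: "field_embedding h" and q: "primepow CARD('k)" and a: "CARD('a) = CARD('k) ^ 2"
  shows "\<exists>x. ftrace h x \<noteq> 0"
proof (rule ccontr)
  assume "\<not> ?thesis"
  hence "(UNIV::'a set) = {x. 1 * x + 1 * x ^ CARD('k) = 0}"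
    using field_trace[OF h q a] field_embedding_0[OF h] by (simp add: set_eq_iff flip: field_trace[OF h q a])
  hence "CARD('a) \<le> CARD('k)"
    using card_power_fixed_le(2)[of "CARD('k)" "1::'a" 1] card_field_ge_2[where 'k='k] by simp
  moreover have "CARD('k) * 2 \<le> CARD('k) ^ 2"
    using card_field_ge_2[where 'k='k] by (simp add: power2_eq_square)
  ultimately show False using a card_field_ge_2[where 'k='k] by linarith
qed

lemma symplectic_trace_form:
  fixes h :: "'k::finite_field \<Rightarrow> 'a::finite_field"
    and f :: "'a ^ 'n::finite \<Rightarrow> 'a ^ 'n \<Rightarrow> 'a"
  assumes h: "field_embedding h" and q: "primepow CARD('k)" and a: "CARD('a) = CARD('k) ^ 2"
    and f: "symplectic_form (*s) f" and c: "c \<noteq> 0"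
  shows "symplectic_form (restrict_scale h) (trace_form h f c)"
proof -
  note tr = field_trace[OF h q a]
  note inj = injD[OF field_embedding_inj[OF h]]
  have hadd: "h (s + t) = h s + h t" and hmul: "h (s * t) = h s * h t" for s t
    using h by (auto simp: field_embedding_def)
  have t_add: "ftrace h (s + t) = ftrace h s + ftrace h t" for s t
    by (rule inj) (simp add: tr hadd card_frobenius_add[OF h q] algebra_simps)
  have hq: "h k ^ CARD('k) = h k" for k using range_field_embedding[OF h] by auto
  have t_mul: "ftrace h (h k * s) = k * ftrace h s" for k s
    by (rule inj) (simp add: tr hmul hq power_mult_distrib algebra_simps)
  have f_lin: "f x (y + z) = f x y + f x z" "f (y + z) x = f y x + f z x"
    "f x (k *s y) = k * f x y" "f (k *s y) x = k * f y x" "f x x = 0" for x y z k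
    using f unfolding symplectic_form_def Vector_Spaces.linear_iff by auto
  have t0: "ftrace h 0 = 0" by (rule inj) (simp add: tr field_embedding_0[OF h])
  have "Vector_Spaces.linear (restrict_scale h) (*) (trace_form h f c x)"
    and "Vector_Spaces.linear (restrict_scale h) (*) (\<lambda>y. trace_form h f c y x)" for x
    by (auto simp: Vector_Spaces.linear_iff vector_space_restrict_scale[OF h]
        vector_space_over_itself.vector_space_axioms trace_form_def restrict_scale_def f_lin
        distrib_left t_add mult.left_commute[of c] t_mul)
  moreover have "trace_form h f c x x = 0" for x by (simp add: trace_form_def f_lin t0)
  moreover have "x = 0" if x: "\<And>y. trace_form h f c x y = 0" for x
  proof (rule ccontr)
    assume "x \<noteq> 0"
    then obtain y where y: "f x y \<noteq> 0" using f unfolding symplectic_form_def by blast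
    obtain t where t: "ftrace h t \<noteq> 0" using field_trace_nonzero[OF h q a] by blast
    have "trace_form h f c x ((t / (c * f x y)) *s y) = ftrace h t"
      using c y by (simp add: trace_form_def f_lin)
    thus False using x t by simp
  qed
  ultimately show ?thesis unfolding symplectic_form_def by blast
qed

end

theory Submission
  imports Defs
begin

text \<open>
  A line of \<open>PG(V)\<close> that shares a nonzero vector \<open>x\<close> with a spread member is conjugate to it iff
  \<open>f(x, \<cdot>)\<close> vanishes on the line. Hence, writing \<open>T\<close> for the isotropic lines of the trace form
  \<open>b\<close> and \<open>U\<close> for the lines on which \<open>f\<close> itself vanishes, the two orbits are
  \<open>O1 = T - U\<close> and \<open>O2 = U - F\<close>, where \<open>F \<subseteq> U \<subseteq> T\<close>. Being dual of symplectic
  type is preserved by differences of nested covers, so it is enough to treat \<open>F\<close>, \<open>U\<close>, \<open>T\<close>.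

  For \<open>T\<close> and \<open>U\<close> let \<open>g\<close> be \<open>b\<close> or \<open>f\<close>, let \<open>C x\<close> be the span of \<open>x\<close> over the
  field of values of \<open>g\<close>, of order \<open>E\<close>, and put \<open>N = |V|\<close> and \<open>S = perp b l\<close>.
  The number of isotropic lines of \<open>g\<close> inside \<open>S\<close>, times \<open>(q^2 - 1) (q^2 - q)\<close>, is the sum of
  \<open>|S \<inter> perp g {x}| - q\<close> over the nonzero \<open>x \<in> S\<close>. Here \<open>perp g {x} = perp b (C x)\<close>
  gives \<open>|S \<inter> perp g {x}| = N |l \<inter> C x| / (q^2 E)\<close>, and
  the sum of \<open>|l \<inter> C x| - 1\<close> over \<open>x\<close> equals, by symmetry of \<open>z \<in> C x\<close>, the sum of
  \<open>|S \<inter> C z| - 1\<close> over the nonzero \<open>z \<in> l\<close>. Finally \<open>|S \<inter> C z|\<close> is \<open>E\<close> or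
  \<open>E / q\<close> according to whether \<open>l\<close> is isotropic for \<open>g\<close>, which produces the two cases of the count.
\<close>

section \<open>Fibre counts and double counting\<close>

text \<open>Translation by \<open>a\<close> identifies the kernel with the fibre through
  \<open>a\<close>, so all fibres over the image have the same size.\<close>

lemma card_eq_image_times_kernel:
  fixes \<phi> :: "'v::ab_group_add \<Rightarrow> 'w::ab_group_add"
  assumes "finite H" and diff: "\<And>x y. x \<in> H \<Longrightarrow> y \<in> H \<Longrightarrow> x - y \<in> H"
    and hom: "\<And>x y. x \<in> H \<Longrightarrow> y \<in> H \<Longrightarrow> \<phi> (x - y) = \<phi> x - \<phi> y"
  shows "card H = card (\<phi> ` H) * card {x \<in> H. \<phi> x = 0}"
proof -
  have fib: "card {x \<in> H. \<phi> x = \<phi> a} = card {x \<in> H. \<phi> x = 0}" if a: "a \<in> H" for a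
  proof (rule bij_betw_same_card[OF bij_betw_byWitness[where f = "\<lambda>x. x - a" and f' = "\<lambda>x. x + a"]])
    have "x + a \<in> H \<and> \<phi> (x + a) = \<phi> a" if x: "x \<in> H" "\<phi> x = 0" for x
    proof -
      \<comment> \<open>Closure of \<open>H\<close> and additivity are given for differences only,
        so \<open>x + a\<close> is reached as \<open>x\<close> minus
        \<open>(a - a) - a\<close>.\<close>
      have 0: "a - a \<in> H" using a diff by blast
      have m: "(a - a) - a \<in> H" using diff[OF 0 a] .
      have "x - ((a - a) - a) \<in> H" using diff[OF x(1) m] .
      moreover have "\<phi> (x - ((a - a) - a)) = \<phi> x - ((\<phi> a - \<phi> a) - \<phi> a)"
        using hom[OF x(1) m] hom[OF 0 a] hom[OF a a] by metis
      ultimately show ?thesis using x by simp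
    qed
    thus "(\<lambda>x. x + a) ` {x \<in> H. \<phi> x = 0} \<subseteq> {x \<in> H. \<phi> x = \<phi> a}" by auto
  qed (use a diff hom in auto)
  have "card H = (\<Sum>u\<in>\<phi> ` H. card {x \<in> H. \<phi> x = u})"
    using sum.image_gen[OF \<open>finite H\<close>, of "\<lambda>_. 1::nat" \<phi>] by simp
  also have "\<dots> = (\<Sum>u\<in>\<phi> ` H. card {x \<in> H. \<phi> x = 0})"
    using fib by (intro sum.cong) auto
  finally show ?thesis by simp
qed

text \<open>Incident pairs of a nonzero vector and a member inside \<open>W\<close> are counted in
  two ways. The lemma serves both the isotropic lines and the spread members.\<close>

lemma sum_card_nonzero_swap:
  fixes W :: "'a::{finite,zero} set"
  shows "(\<Sum>k\<in>{k \<in> L. k \<subseteq> W}. card (k - {0})) = (\<Sum>x\<in>W - {0}. card {k \<in> L. x \<in> k \<and> k \<subseteq> W})"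
proof -
  have "(\<Sum>k\<in>{k \<in> L. k \<subseteq> W}. card (k - {0})) =
      (\<Sum>k\<in>{k \<in> L. k \<subseteq> W}. \<Sum>x\<in>{x \<in> W - {0}. x \<in> k}. 1)"
    by (intro sum.cong) (auto intro!: arg_cong[where f = card])
  also have "\<dots> = (\<Sum>x\<in>W - {0}. \<Sum>k\<in>{k \<in> {k \<in> L. k \<subseteq> W}. x \<in> k}. 1)"
    by (rule sum.swap_restrict) simp_all
  also have "\<dots> = (\<Sum>x\<in>W - {0}. card {k \<in> L. x \<in> k \<and> k \<subseteq> W})"
    by (intro sum.cong) (auto intro!: arg_cong[where f = card])
  finally show ?thesis .
qed

section \<open>Subspaces, points and lines over a finite field\<close>

locale finite_space = vector_space scale
  for scale :: "'k::{field,finite} \<Rightarrow> 'v::{ab_group_add,finite} \<Rightarrow> 'v"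
begin

text \<open>Since \<open>a\<close> is outside \<open>span B\<close>, the pairs of a scalar
  \<open>k\<close> and a vector \<open>w\<close> of \<open>span B\<close> correspond bijectively to
  the vectors \<open>scale k a + w\<close>.\<close>

lemma card_span_insert:
  assumes "a \<notin> span B"
  shows "card (span (insert a B)) = CARD('k) * card (span B)"
proof -
  let ?f = "\<lambda>(k, w). scale k a + w"
  have "inj_on ?f (UNIV \<times> span B)"
  proof (rule inj_onI, clarify)
    fix k w k' w'
    assume w: "w \<in> span B" "w' \<in> span B" and e: "scale k a + w = scale k' a + w'"
    have "scale (k - k') a = w' - w"
      using e by (simp add: scale_left_diff_distrib algebra_simps)
    hence s: "scale (k - k') a \<in> span B" using w span_diff by metis
    have "k = k'"
    proof (rule ccontr)
      assume "k \<noteq> k'"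
      hence "scale (inverse (k - k')) (scale (k - k') a) = a" by simp
      thus False using s span_scale assms by metis
    qed
    thus "k = k' \<and> w = w'" using e by simp
  qed
  moreover have "?f ` (UNIV \<times> span B) = span (insert a B)"
  proof (rule set_eqI)
    fix x
    have "x - scale k a \<in> span B \<longleftrightarrow> (\<exists>w\<in>span B. x = scale k a + w)" for k
      by (metis add_diff_cancel_left' add.commute diff_add_cancel)
    hence "x \<in> span (insert a B) \<longleftrightarrow> (\<exists>k. \<exists>w\<in>span B. x = scale k a + w)"
      unfolding span_insert by simp
    thus "x \<in> ?f ` (UNIV \<times> span B) \<longleftrightarrow> x \<in> span (insert a B)" by auto
  qed
  ultimately have "card (span (insert a B)) = card ((UNIV :: 'k set) \<times> span B)"
    using card_image by metis
  thus ?thesis by simp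
qed

lemma card_subspace:
  assumes "subspace W"
  shows "card W = CARD('k) ^ dim W"
proof -
  obtain B where B: "B \<subseteq> W" "independent B" "W \<subseteq> span B" "card B = dim W"
    by (rule basis_exists)
  have "finite B" by simp
  hence "independent B \<Longrightarrow> card (span B) = CARD('k) ^ card B"
    by (induction B) (auto simp: card_span_insert independent_insert)
  moreover have "span B = W" using B assms span_minimal by blast
  ultimately show ?thesis using B by simp
qed

lemma field_card_ge_2: "CARD('k) \<ge> 2"
  by (rule card_field_ge_2)

text \<open>Powers of \<open>CARD('k)\<close> determine their exponents, so points and lines can be
  recognised by cardinality alone.\<close>

lemma dim_eq_iff_card:
  assumes "subspace W"
  shows "dim W = k \<longleftrightarrow> card W = CARD('k) ^ k"
  unfolding card_subspace[OF assms] using field_card_ge_2 by auto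

lemma card_span_singleton: "x \<noteq> 0 \<Longrightarrow> card (span {x}) = CARD('k)"
  using card_span_insert[of x "{}"] by simp

lemma span_singleton_eq:
  assumes "y \<in> span {x}" "y \<noteq> 0"
  shows "span {y} = span {x}"
proof -
  have "span {y} \<subseteq> span {x}" using assms(1) span_minimal[of "{y}" "span {x}"] by simp
  moreover have "x \<noteq> 0" using assms by auto
  ultimately show ?thesis
    using card_span_singleton[OF assms(2)] card_span_singleton[of x] by (intro card_subset_eq) auto
qed

text \<open>A functional that is nonzero on \<open>W\<close> maps \<open>W\<close> onto the field,
  so its kernel in \<open>W\<close> has index \<open>CARD('k)\<close>.\<close>

lemma card_functional_kernel:
  assumes "subspace W" and \<phi>: "Vector_Spaces.linear scale (*) \<phi>" and "w \<in> W" "\<phi> w \<noteq> 0"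
  shows "card W = CARD('k) * card {x \<in> W. \<phi> x = 0}"
proof -
  have "\<phi> ` W = UNIV"
  proof (intro set_eqI iffI UNIV_I)
    fix k :: 'k
    have "\<phi> (scale (k / \<phi> w) w) = k" using \<phi> assms(4) by (simp add: Vector_Spaces.linear_iff)
    thus "k \<in> \<phi> ` W" using subspace_scale[OF assms(1,3)] by (metis imageI)
  qed
  moreover have "\<phi> (x - y) = \<phi> x - \<phi> y" for x y
  proof -
    have "\<phi> ((x - y) + y) = \<phi> (x - y) + \<phi> y"
      using \<phi> unfolding Vector_Spaces.linear_iff by blast
    thus ?thesis by simp
  qed
  ultimately show ?thesis
    using card_eq_image_times_kernel[of W \<phi>] subspace_diff[OF assms(1)] by simp
qed

text \<open>Addition on \<open>A \<times> B\<close> has image \<open>A + B\<close>, and its kernel,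
  the vectors \<open>(x, - x)\<close>, is a copy of \<open>A \<inter> B\<close>.\<close>

lemma card_subspace_sum:
  assumes A: "subspace A" and B: "subspace B"
  shows "card {x + y |x y. x \<in> A \<and> y \<in> B} * card (A \<inter> B) = card A * card B"
proof -
  have "card (A \<times> B) = card ((\<lambda>p. fst p + snd p) ` (A \<times> B)) * card {p \<in> A \<times> B. fst p + snd p = 0}"
    using subspace_diff[OF A] subspace_diff[OF B]
    by (intro card_eq_image_times_kernel) (auto simp: algebra_simps)
  moreover have "(\<lambda>p. fst p + snd p) ` (A \<times> B) = {x + y |x y. x \<in> A \<and> y \<in> B}" by force
  moreover have "{p \<in> A \<times> B. fst p + snd p = 0} = (\<lambda>x. (x, - x)) ` (A \<inter> B)"
  proof (intro equalityI subsetI)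
    fix p assume "p \<in> {p \<in> A \<times> B. fst p + snd p = 0}"
    hence p: "fst p \<in> A" "snd p \<in> B" "snd p = - fst p"
      by (auto simp: eq_neg_iff_add_eq_0 add.commute)
    hence "fst p \<in> A \<inter> B" using subspace_neg[OF B p(2)] by simp
    thus "p \<in> (\<lambda>x. (x, - x)) ` (A \<inter> B)" using p(3) by (intro image_eqI[of _ _ "fst p"]) (simp_all add: prod_eq_iff)
  qed (use subspace_neg[OF B] in auto)
  moreover have "inj_on (\<lambda>x::'v. (x, - x)) (A \<inter> B)" by (auto intro: inj_onI)
  ultimately show ?thesis by (simp add: card_image card_cartesian_product)
qed

lemma pg_lines_iff: "l \<in> pg_lines scale \<longleftrightarrow> subspace l \<and> card l = CARD('k)\<^sup>2"
  by (auto simp: pg_lines_def dim_eq_iff_card)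

lemma pg_points_iff: "P \<in> pg_points scale \<longleftrightarrow> (\<exists>x. x \<noteq> 0 \<and> P = span {x})"
proof
  assume "P \<in> pg_points scale"
  hence P: "subspace P" "card P = CARD('k)"
    using dim_eq_iff_card[of P 1] unfolding pg_points_def by auto
  have "\<not> P \<subseteq> {0}"
  proof
    assume "P \<subseteq> {0}"
    hence "card P \<le> card {0::'v}" by (intro card_mono) simp_all
    thus False using P(2) field_card_ge_2 by simp
  qed
  then obtain x where x: "x \<in> P" "x \<noteq> 0" by blast
  have "span {x} \<subseteq> P" using P(1) x(1) by (intro span_minimal) simp_all
  hence "span {x} = P"
    using P(2) card_span_singleton[OF x(2)] by (intro card_subset_eq) simp_all
  thus "\<exists>x. x \<noteq> 0 \<and> P = span {x}" using x(2) by blast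
next
  assume "\<exists>x. x \<noteq> 0 \<and> P = span {x}"
  then obtain x where x: "x \<noteq> 0" "P = span {x}" by blast
  show "P \<in> pg_points scale"
    using dim_eq_iff_card[OF subspace_span, of "{x}" 1] card_span_singleton[OF x(1)] x(2)
    unfolding pg_points_def by (simp del: dim_span)
qed

lemma subspace_pg_line: "l \<in> pg_lines scale \<Longrightarrow> subspace l"
  by (simp add: pg_lines_iff)

lemma point_subset_iff:
  assumes "subspace l" shows "span {x} \<subseteq> l \<longleftrightarrow> x \<in> l"
proof
  assume "x \<in> l" thus "span {x} \<subseteq> l" using assms by (intro span_minimal) simp_all
qed (use span_superset[of "{x}"] in blast)

lemma span_pair_in_pg_lines:
  assumes "x \<noteq> 0" "y \<notin> span {x}"
  shows "span {x, y} \<in> pg_lines scale"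
  using card_span_insert[OF assms(2)] card_span_singleton[OF assms(1)]
  by (simp add: pg_lines_iff insert_commute power2_eq_square)

lemma pg_line_eq_span:
  assumes "l \<in> pg_lines scale" "x \<in> l" "y \<in> l" "x \<noteq> 0" "y \<notin> span {x}"
  shows "l = span {x, y}"
proof -
  have "span {x, y} \<subseteq> l"
    using assms span_minimal[of "{x, y}" l] by (simp add: pg_lines_iff)
  thus ?thesis
    using assms span_pair_in_pg_lines[OF assms(4,5)] card_subset_eq[of l "span {x, y}"]
    by (simp add: pg_lines_iff)
qed

lemma pg_line_nonzero_vector:
  assumes "l \<in> pg_lines scale"
  obtains x where "x \<in> l" "x \<noteq> 0"
proof -
  have "\<not> l \<subseteq> {0}"
  proof
    assume "l \<subseteq> {0}"
    hence "card l \<le> card {0 :: 'v}" by (intro card_mono) simp_all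
    moreover have "card l = CARD('k) * CARD('k)"
      using assms by (simp add: pg_lines_iff power2_eq_square)
    ultimately show False
      using mult_le_mono[OF field_card_ge_2 field_card_ge_2] by simp
  qed
  thus ?thesis using that by blast
qed

lemma pg_line_other_point:
  assumes "l \<in> pg_lines scale" "x \<in> l" "x \<noteq> 0"
  obtains y where "y \<in> l" "y \<notin> span {x}" "l = span {x, y}"
proof -
  have "CARD('k) < CARD('k)\<^sup>2" using field_card_ge_2 by (simp add: power2_eq_square)
  hence "\<not> l \<subseteq> span {x}"
    using card_mono[of "span {x}" l] card_span_singleton[OF assms(3)] assms(1)
    by (auto simp: pg_lines_iff)
  thus ?thesis using that pg_line_eq_span assms by blast
qed

text \<open>With the point \<open>span {x}\<close> removed from each, the lines through
  \<open>x\<close> inside \<open>W\<close> partition \<open>W - span {x}\<close> into blocks of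
  equal size.\<close>

lemma card_lines_through:
  assumes W: "subspace W" and x: "x \<in> W" "x \<noteq> 0"
  shows "card {k \<in> pg_lines scale. x \<in> k \<and> k \<subseteq> W} * (CARD('k)\<^sup>2 - CARD('k)) = card W - CARD('k)"
proof -
  let ?A = "{k \<in> pg_lines scale. x \<in> k \<and> k \<subseteq> W}"
  have sub: "span {x} \<subseteq> k" if "subspace k" "x \<in> k" for k
    using that span_minimal[of "{x}" k] by simp
  have card: "card (k - span {x}) = card k - CARD('k)" if "subspace k" "x \<in> k" for k
    using card_Diff_subset[OF _ sub[OF that]] card_span_singleton[OF x(2)] by simp
  have "(\<Union>k\<in>?A. k - span {x}) = W - span {x}"
  proof (intro equalityI subsetI)
    fix y assume y: "y \<in> W - span {x}"
    have "span {x, y} \<subseteq> W" using W x y span_minimal[of "{x, y}" W] by simp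
    hence "span {x, y} \<in> ?A"
      using y span_pair_in_pg_lines[of x y] x span_base[of x "{x, y}"] by auto
    moreover have "y \<in> span {x, y}" by (simp add: span_base)
    ultimately show "y \<in> (\<Union>k\<in>?A. k - span {x})" using y by blast
  qed auto
  hence "card W - CARD('k) = card (\<Union>k\<in>?A. k - span {x})" using card[OF W x(1)] by simp
  also have "\<dots> = (\<Sum>k\<in>?A. card (k - span {x}))"
  proof (intro card_UN_disjoint ballI impI)
    fix k l assume kl: "k \<in> ?A" "l \<in> ?A" "k \<noteq> l"
    have "k = span {x, y}" "l = span {x, y}" if "y \<in> k" "y \<in> l" "y \<notin> span {x}" for y
      using kl(1,2) that x(2) by (simp_all add: pg_line_eq_span)
    thus "(k - span {x}) \<inter> (l - span {x}) = {}" using kl(3) by auto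
  qed simp_all
  also have "\<dots> = (\<Sum>k\<in>?A. CARD('k)\<^sup>2 - CARD('k))"
    using card by (intro sum.cong) (auto simp: pg_lines_iff)
  finally show ?thesis by simp
qed

end

section \<open>Perpendicular spaces of a symplectic form\<close>

locale symplectic_space = finite_space scale
  for scale :: "'k::{field,finite} \<Rightarrow> 'v::{ab_group_add,finite} \<Rightarrow> 'v" +
  fixes b :: "'v \<Rightarrow> 'v \<Rightarrow> 'k"
  assumes symplectic: "symplectic_form scale b"
begin

lemma linear_form: "Vector_Spaces.linear scale (*) (b x)"
  "Vector_Spaces.linear scale (*) (\<lambda>x. b x y)"
  using symplectic by (auto simp: symplectic_form_def)

lemma form_simps [simp]:
  "b x (y + z) = b x y + b x z" "b (x + y) z = b x z + b y z"
  "b x (scale k y) = k * b x y" "b (scale k x) y = k * b x y" "b x x = 0"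
  using symplectic by (auto simp: symplectic_form_def Vector_Spaces.linear_iff)

lemma form_0 [simp]: "b x 0 = 0" "b 0 x = 0"
  using form_simps(3)[of x 0 0] form_simps(4)[of 0 0 x] by simp_all

lemma form_swap: "b y x = - b x y"
proof -
  have "b (x + y) (x + y) = b x y + b y x" by (simp del: form_simps(5)) (simp add: form_simps(5))
  thus ?thesis by (simp add: eq_neg_iff_add_eq_0 add.commute)
qed

lemma orthogonal_commute: "b x y = 0 \<longleftrightarrow> b y x = 0"
  by (simp add: form_swap[of x y])

lemma subspace_perp: "subspace (perp b S)"
  by (auto simp: subspace_def perp_def)

lemma subset_perp_commute: "A \<subseteq> perp b B \<longleftrightarrow> B \<subseteq> perp b A"
  using orthogonal_commute by (auto simp: perp_def)

lemma perp_span: "perp b (span S) = perp b S"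
proof
  have "S \<subseteq> perp b (perp b S)" using subset_perp_commute by blast
  hence "span S \<subseteq> perp b (perp b S)" by (intro span_minimal subspace_perp)
  thus "perp b S \<subseteq> perp b (span S)" using subset_perp_commute by blast
  show "perp b (span S) \<subseteq> perp b S" using span_superset unfolding perp_def by blast
qed

lemma perp_Un: "perp b (A \<union> B) = perp b A \<inter> perp b B"
  by (auto simp: perp_def)

text \<open>Both sides of the identity count the orthogonal pairs in \<^term>\<open>W \<times> UNIV\<close>.\<close>

lemma card_perp:
  assumes W: "subspace W"
  shows "card (perp b W) * card W = CARD('v)"
proof -
  let ?N = "CARD('v)"
  \<comment> \<open>For \<open>w \<noteq> 0\<close> the kernel of \<open>b w\<close> has index
    \<open>CARD('k)\<close>; this factor avoids a division.\<close>
  have "(\<Sum>w\<in>W. CARD('k) * card {v. b w v = 0}) = (\<Sum>w\<in>W. if w = 0 then CARD('k) * ?N else ?N)"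
  proof (intro sum.cong refl)
    fix w assume "w \<in> W"
    show "CARD('k) * card {v. b w v = 0} = (if w = 0 then CARD('k) * ?N else ?N)"
    proof (cases "w = 0")
      case False
      then obtain v where "b w v \<noteq> 0" using symplectic unfolding symplectic_form_def by blast
      thus ?thesis
        using card_functional_kernel[OF subspace_UNIV linear_form(1), of v w] False by simp
    qed simp
  qed
  also have "\<dots> = CARD('k) * ?N + (card W - 1) * ?N"
    using subspace_0[OF W] by (subst sum.remove[of W 0]) simp_all
  finally have left: "(\<Sum>w\<in>W. CARD('k) * card {v. b w v = 0}) = CARD('k) * ?N + (card W - 1) * ?N" .
  have "(\<Sum>v\<in>UNIV. CARD('k) * card {w \<in> W. b w v = 0}) =
      (\<Sum>v\<in>UNIV. if v \<in> perp b W then CARD('k) * card W else card W)"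
  proof (intro sum.cong refl)
    fix v
    show "CARD('k) * card {w \<in> W. b w v = 0} = (if v \<in> perp b W then CARD('k) * card W else card W)"
    proof (cases "v \<in> perp b W")
      case True
      hence "{w \<in> W. b w v = 0} = W" by (auto simp: perp_def)
      thus ?thesis using True by simp
    next
      case False
      then obtain w where "w \<in> W" "b w v \<noteq> 0" by (auto simp: perp_def)
      thus ?thesis using card_functional_kernel[OF W linear_form(2), of w v] False by simp
    qed
  qed
  also have "\<dots> = card (perp b W) * (CARD('k) * card W) + card (- perp b W) * card W"
    by (simp add: sum.If_cases)
  also have "card (- perp b W) = ?N - card (perp b W)"
    by (simp add: Compl_eq_Diff_UNIV card_Diff_subset)
  finally have right: "(\<Sum>v\<in>UNIV. CARD('k) * card {w \<in> W. b w v = 0}) =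
      card (perp b W) * (CARD('k) * card W) + (?N - card (perp b W)) * card W" .
  have "(\<Sum>w\<in>W. card {v. b w v = 0}) = (\<Sum>v\<in>UNIV. card {w \<in> W. b w v = 0})"
    using sum.swap_restrict[of W UNIV "\<lambda>_ _. 1::nat" "\<lambda>w v. b w v = 0"] by simp
  hence "CARD('k) * ?N + (card W - 1) * ?N =
      card (perp b W) * (CARD('k) * card W) + (?N - card (perp b W)) * card W"
    using left right by (simp only: sum_distrib_left[symmetric])
  \<comment> \<open>Over the reals the truncated differences become genuine ones and can be
    expanded.\<close>
  hence eq: "real (CARD('k) * ?N + (card W - 1) * ?N) =
      real (card (perp b W) * (CARD('k) * card W) + (?N - card (perp b W)) * card W)"
    by (simp only:)
  have pos: "1 \<le> card W"
    using subspace_0[OF W] by (metis One_nat_def Suc_leI card_gt_0_iff empty_iff finite)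
  have le: "card (perp b W) \<le> ?N" by (rule card_mono) simp_all
  have "real CARD('k) * ?N + (real (card W) - 1) * ?N =
      card (perp b W) * (real CARD('k) * card W) + (real ?N - card (perp b W)) * card W"
    using eq by (simp only: of_nat_add of_nat_mult of_nat_diff[OF pos] of_nat_diff[OF le] of_nat_1)
  \<comment> \<open>The terms \<open>?N * card W\<close> cancel, which leaves the claim multiplied
    by \<open>CARD('k) - 1\<close>.\<close>
  hence "(real CARD('k) - 1) * (real (card (perp b W)) * real (card W)) = (real CARD('k) - 1) * real ?N"
    by (simp add: algebra_simps)
  hence "real (card (perp b W) * card W) = real ?N" using field_card_ge_2 by simp
  thus ?thesis by (simp only: of_nat_eq_iff)
qed

text \<open>A line contains the point spanned by \<open>x\<close> iff it contains \<open>x\<close>,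
  so degrees may be computed at nonzero vectors.\<close>

lemma m_coverI:
  assumes "m > 0" and L: "L \<subseteq> polar_lines scale b"
    and m: "\<And>x. x \<noteq> 0 \<Longrightarrow> card {l \<in> L. x \<in> l} = m"
  shows "m_cover scale b m L"
  unfolding m_cover_def
proof (intro conjI ballI)
  fix P assume "P \<in> pg_points scale"
  then obtain x where x: "x \<noteq> 0" "P = span {x}" unfolding pg_points_iff by blast
  have "{l \<in> L. P \<subseteq> l} = {l \<in> L. x \<in> l}"
    using L point_subset_iff subspace_pg_line unfolding x(2) polar_lines_def by blast
  thus "card {l \<in> L. P \<subseteq> l} = m" using m x(1) by simp
qed (use assms in auto)

text \<open>Here \<open>r = d + 2\<close> and \<open>N = q ^ (r + 1)\<close>, so
  \<open>q ^ (r - 3) = N / q ^ 4\<close>. Summing the geometric series turns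
  \<open>theta (r - 4) q / (q + 1)\<close> into
  \<open>(N / q ^ 4 - 1) / (q ^ 2 - 1)\<close>.\<close>

lemma dual_of_symplectic_typeI:
  assumes d: "d \<ge> 1" and N: "CARD('v) = CARD('k) ^ (d + 3)"
    and L: "m_cover scale b m L"
    and eq: "\<And>l. l \<in> pg_lines scale \<Longrightarrow> real (card {k \<in> L. k \<subseteq> perp b l}) =
      real m * (real CARD('v) / real CARD('k) ^ 4 - 1) / ((real CARD('k))\<^sup>2 - 1) +
      (if l \<in> L then real CARD('v) / real CARD('k) ^ 4 else 0)"
  shows "dual_of_symplectic_type scale b d m L"
proof -
  let ?q = "real CARD('k)"
  have q: "?q \<ge> 2" using field_card_ge_2 by (metis of_nat_le_iff of_nat_numeral)
  have Nq: "real CARD('v) / ?q ^ 4 = ?q ^ (d - 1)"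
  proof -
    have "d + 3 = (d - 1) + 4" using d by simp
    hence "real CARD('v) = ?q ^ (d - 1) * ?q ^ 4"
      unfolding N of_nat_power by (metis power_add)
    thus ?thesis using q by simp
  qed
  \<comment> \<open>The sum defining \<open>theta\<close> has \<open>d - 1\<close> terms here; it is
    empty for \<open>d = 1\<close>.\<close>
  have "nat (int (d + 2) - 4 + 1) = d - 1" by simp
  hence "real (theta (int (d + 2) - 4) CARD('k)) * (?q - 1) = ?q ^ (d - 1) - 1"
    unfolding theta_def by (simp add: power_diff_1_eq mult.commute)
  hence "real m * (?q ^ (d - 1) - 1) / (?q\<^sup>2 - 1) =
      real m * (real (theta (int (d + 2) - 4) CARD('k)) * (?q - 1)) / (?q\<^sup>2 - 1)"
    by simp
  also have "?q\<^sup>2 - 1 = (?q + 1) * (?q - 1)" by (simp add: power2_eq_square algebra_simps)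
  finally have "real m * (?q ^ (d - 1) - 1) / (?q\<^sup>2 - 1) =
      real m * real (theta (int (d + 2) - 4) CARD('k)) / (?q + 1)"
    using q by (simp add: \<open>?q\<^sup>2 - 1 = (?q + 1) * (?q - 1)\<close>)
  moreover have "dim (UNIV :: 'v set) = d + 2 + 1"
    using dim_eq_iff_card[OF subspace_UNIV, of "d + 3"] N by simp
  ultimately show ?thesis
    using eq L unfolding dual_of_symplectic_type_def Let_def Nq by simp
qed

end

section \<open>Differences of nested covers\<close>

lemma m_cover_diff:
  fixes smul :: "'k::field \<Rightarrow> 'v::{ab_group_add,finite} \<Rightarrow> 'v"
  assumes L: "m_cover smul b m L" and L': "m_cover smul b m' L'" and "L' \<subseteq> L" "m' < m"
  shows "m_cover smul b (m - m') (L - L')"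
proof -
  have "card {l \<in> L - L'. P \<subseteq> l} = m - m'" if "P \<in> pg_points smul" for P
  proof -
    have "card ({l \<in> L. P \<subseteq> l} - {l \<in> L'. P \<subseteq> l}) = m - m'"
      using assms that by (subst card_Diff_subset) (auto simp: m_cover_def)
    moreover have "{l \<in> L - L'. P \<subseteq> l} = {l \<in> L. P \<subseteq> l} - {l \<in> L'. P \<subseteq> l}" by auto
    ultimately show ?thesis by simp
  qed
  thus ?thesis using assms by (auto simp: m_cover_def)
qed

text \<open>The prescribed count is linear in \<open>m\<close> plus a fixed multiple of the
  indicator of the cover, and for \<open>L' \<subseteq> L\<close> the indicator of
  \<open>L - L'\<close> is the difference of the indicators.\<close>

lemma dual_of_symplectic_type_diff:
  fixes smul :: "'k::field \<Rightarrow> 'v::{ab_group_add,finite} \<Rightarrow> 'v"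
  assumes L: "dual_of_symplectic_type smul b d m L" and L': "dual_of_symplectic_type smul b d m' L'"
    and sub: "L' \<subseteq> L" and m: "m' < m"
  shows "dual_of_symplectic_type smul b d (m - m') (L - L')"
proof -
  have "real (card {k \<in> L - L'. k \<subseteq> perp b l}) =
      real (card {k \<in> L. k \<subseteq> perp b l}) - real (card {k \<in> L'. k \<subseteq> perp b l})" for l
  proof -
    have "{k \<in> L - L'. k \<subseteq> perp b l} = {k \<in> L. k \<subseteq> perp b l} - {k \<in> L'. k \<subseteq> perp b l}" by auto
    moreover have "{k \<in> L'. k \<subseteq> perp b l} \<subseteq> {k \<in> L. k \<subseteq> perp b l}" using sub by auto
    ultimately show ?thesis by (simp add: card_Diff_subset of_nat_diff card_mono)
  qed
  moreover have "m_cover smul b (m - m') (L - L')"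
    using assms by (intro m_cover_diff) (auto simp: dual_of_symplectic_type_def Let_def)
  ultimately show ?thesis
    using L L' sub m unfolding dual_of_symplectic_type_def Let_def
    by (auto simp: of_nat_diff left_diff_distrib diff_divide_distrib)
qed

section \<open>Counting isotropic lines through a trace map\<close>

text \<open>
  With \<open>sc = smul\<close>, \<open>g = b\<close> this also covers the polar space of \<open>b\<close> itself, so that the
  isotropic lines of \<open>b\<close> and of \<open>g\<close> are counted by the same argument.
\<close>

locale trace_geometry =
  K: symplectic_space smul b + C: symplectic_space sc g
  for smul :: "'k::{field,finite} \<Rightarrow> 'v::{ab_group_add,finite} \<Rightarrow> 'v" and b
    and sc :: "'c::{field,finite} \<Rightarrow> 'v \<Rightarrow> 'v" and g +
  fixes j :: "'k \<Rightarrow> 'c" and tr :: "'c \<Rightarrow> 'k"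
  assumes smul_eq: "smul k v = sc (j k) v"
    and b_eq: "b x y = tr (g x y)"
    and tr_0: "tr 0 = 0"
    and tr_nondegenerate: "u \<noteq> 0 \<Longrightarrow> \<exists>a. tr (a * u) \<noteq> 0"
begin

text \<open>The lines are taken over \<open>'k\<close>, but isotropy refers to the
  \<open>'c\<close>-valued form \<open>g\<close>. This is \<open>U\<close> for the quadratic
  extension and \<open>T\<close> when \<open>g = b\<close>.\<close>

definition isotropic_lines :: "'v set set" where
  "isotropic_lines = {l \<in> pg_lines smul. l \<subseteq> perp g l}"

lemma subspace_restrict: "C.subspace W \<Longrightarrow> K.subspace W"
  by (auto simp: K.subspace_def C.subspace_def smul_eq)

text \<open>The values \<open>b (sc a x) y\<close> are \<open>tr (a * g x y)\<close>, and by
  nondegeneracy of \<open>tr\<close> they vanish for all \<open>a\<close> only if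
  \<open>g x y = 0\<close>. Perps of vectors under \<open>g\<close> thus become perps of subspaces
  under \<open>b\<close>, whose sizes are known.\<close>

lemma perp_C_span: "perp b (C.span {x}) = perp g {x}"
proof -
  have "(\<forall>a. tr (a * g x y) = 0) \<longleftrightarrow> g x y = 0" for y
    using tr_nondegenerate[of "g x y"] tr_0 by auto
  thus ?thesis by (auto simp: perp_def C.span_singleton b_eq)
qed

lemma isotropic_lines_subset: "isotropic_lines \<subseteq> polar_lines smul b"
  by (auto simp: isotropic_lines_def polar_lines_def perp_def b_eq tr_0)

text \<open>The line is spanned by \<open>x\<close> and some \<open>y\<close>; since
  \<open>g\<close> is alternating, it vanishes on the whole line as soon as
  \<open>g x y = 0\<close>.\<close>

lemma isotropic_iff_perp_point:
  assumes l: "l \<in> pg_lines smul" and x: "x \<in> l" "x \<noteq> 0"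
  shows "l \<subseteq> perp g l \<longleftrightarrow> l \<subseteq> perp g {x}"
proof
  assume "l \<subseteq> perp g l"
  thus "l \<subseteq> perp g {x}" using x by (auto simp: perp_def)
next
  assume lx: "l \<subseteq> perp g {x}"
  obtain y where y: "y \<in> l" "l = K.span {x, y}" using K.pg_line_other_point[OF l x] by blast
  have "g x y = 0" using lx y(1) by (auto simp: perp_def)
  hence "{x, y} \<subseteq> perp g {x, y}" using C.orthogonal_commute[of x y] by (auto simp: perp_def)
  \<comment> \<open>Spans are taken in one argument of \<open>g\<close> and then, by symmetry of
    orthogonality, in the other.\<close>
  hence "l \<subseteq> perp g {x, y}"
    unfolding y(2) by (rule K.span_minimal[OF _ subspace_restrict[OF C.subspace_perp]])
  hence "{x, y} \<subseteq> perp g l" by (rule C.subset_perp_commute[THEN iffD1])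
  hence "K.span {x, y} \<subseteq> perp g l"
    by (rule K.span_minimal[OF _ subspace_restrict[OF C.subspace_perp]])
  thus "l \<subseteq> perp g l" using y(2) by (rule ord_eq_le_trans[rotated])
qed

lemma isotropic_lines_through:
  assumes W: "x \<in> W" "x \<noteq> 0"
  shows "{k \<in> isotropic_lines. x \<in> k \<and> k \<subseteq> W} =
    {k \<in> pg_lines smul. x \<in> k \<and> k \<subseteq> W \<inter> perp g {x}}"
  using isotropic_iff_perp_point W(2) by (auto simp: isotropic_lines_def)

text \<open>The isotropic lines through \<open>x\<close> are the lines through \<open>x\<close>
  inside \<open>perp g {x}\<close>, so \<open>card_lines_through\<close> applies to
  \<open>W \<inter> perp g {x}\<close>.\<close>

lemma card_isotropic_lines_through:
  assumes "K.subspace W" "x \<in> W" "x \<noteq> 0"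
  shows "real (card {k \<in> isotropic_lines. x \<in> k \<and> k \<subseteq> W}) * (real CARD('k) ^ 2 - real CARD('k)) =
    real (card (W \<inter> perp g {x})) - real CARD('k)"
proof -
  let ?W = "W \<inter> perp g {x}"
  have W: "K.subspace ?W"
    using K.subspace_inter[OF assms(1) subspace_restrict[OF C.subspace_perp]] .
  have x: "x \<in> ?W" using assms(2) by (simp add: perp_def)
  have "K.span {x} \<subseteq> ?W" using W x by (intro K.span_minimal) simp_all
  hence "CARD('k) \<le> card ?W"
    using K.card_span_singleton[OF assms(3)] card_mono[of ?W "K.span {x}"] by simp
  moreover have "CARD('k) \<le> CARD('k)\<^sup>2" by (simp add: power2_eq_square)
  moreover have "real (card {k \<in> isotropic_lines. x \<in> k \<and> k \<subseteq> W} * (CARD('k)\<^sup>2 - CARD('k))) =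
      real (card ?W - CARD('k))"
    unfolding isotropic_lines_through[OF assms(2,3)] K.card_lines_through[OF W x assms(3)] ..
  ultimately show ?thesis by (simp add: of_nat_diff)
qed

text \<open>The intersection of the two perps is the perp of \<open>A + B\<close>, whose size
  follows from \<open>card_subspace_sum\<close>.\<close>

lemma card_perp_sum:
  assumes A: "K.subspace A" and B: "K.subspace B"
  shows "card (perp b A \<inter> perp b B) * (card A * card B) = CARD('v) * card (A \<inter> B)"
proof -
  have "K.span (A \<union> B) = {x + y |x y. x \<in> A \<and> y \<in> B}"
    unfolding K.span_Un K.span_eq_iff[THEN iffD2, OF A] K.span_eq_iff[THEN iffD2, OF B] by simp
  hence "card (K.span (A \<union> B)) * card (A \<inter> B) = card A * card B"
    using K.card_subspace_sum[OF A B] by simp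
  moreover have "card (perp b A \<inter> perp b B) * card (K.span (A \<union> B)) = CARD('v)"
    using K.card_perp[OF K.subspace_span, of "A \<union> B"] by (simp add: K.perp_span K.perp_Un)
  ultimately show ?thesis by (metis mult.assoc)
qed

text \<open>Write \<open>l\<close> as the span of \<open>z\<close> and \<open>y\<close>. On
  \<open>C.span {z}\<close> the functional \<open>b z\<close> vanishes, so \<open>perp b l\<close>
  is cut out there by \<open>b y\<close> alone, which vanishes on \<open>C.span {z}\<close> exactly
  when \<open>l\<close> is isotropic for \<open>g\<close>.\<close>

lemma card_perp_inter_point:
  assumes l: "l \<in> pg_lines smul" and z: "z \<in> l" "z \<noteq> 0"
  shows "card (perp b l \<inter> C.span {z}) * (if l \<in> isotropic_lines then 1 else CARD('k)) = CARD('c)"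
proof -
  obtain y where y: "y \<in> l" "l = K.span {z, y}" using K.pg_line_other_point[OF l z] by blast
  have bz: "b z w = 0" if "w \<in> C.span {z}" for w
  proof -
    have "z \<in> perp b (C.span {z})" unfolding perp_C_span by (simp add: perp_def)
    thus ?thesis using that K.orthogonal_commute by (auto simp: perp_def)
  qed
  have "perp b l = perp b {z, y}" unfolding y(2) by (rule K.perp_span)
  hence S: "perp b l \<inter> C.span {z} = {w \<in> C.span {z}. b y w = 0}"
    using bz by (auto simp: perp_def)
  have iso: "l \<in> isotropic_lines \<longleftrightarrow> (\<forall>w\<in>C.span {z}. b y w = 0)"
  proof -
    have "l \<in> isotropic_lines \<longleftrightarrow> l \<subseteq> perp b (C.span {z})"
      using isotropic_iff_perp_point[OF l z] l by (simp add: isotropic_lines_def perp_C_span)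
    also have "\<dots> \<longleftrightarrow> C.span {z} \<subseteq> perp b l" by (rule K.subset_perp_commute)
    also have "\<dots> \<longleftrightarrow> (\<forall>w\<in>C.span {z}. b y w = 0)"
      using S by blast
    finally show ?thesis .
  qed
  show ?thesis
  proof (cases "l \<in> isotropic_lines")
    case True
    hence "{w \<in> C.span {z}. b y w = 0} = C.span {z}" using iso by blast
    thus ?thesis using True S C.card_span_singleton[OF z(2)] by simp
  next
    case False
    then obtain w where w: "w \<in> C.span {z}" "b y w \<noteq> 0" using iso by blast
    have "card (C.span {z}) = CARD('k) * card {w \<in> C.span {z}. b y w = 0}"
      by (rule K.card_functional_kernel[OF subspace_restrict K.linear_form(1) w]) simp
    thus ?thesis using False S C.card_span_singleton[OF z(2)] by simp
  qed
qed

text \<open>Denominators are cleared: \<open>q ^ 2 - 1\<close> counts the nonzero vectors of a line,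
  \<open>q ^ 2 - q\<close> the vectors of a line off one of its points, and \<open>q ^ 2 * E\<close>
  is the product of the sizes of \<open>l\<close> and \<open>C.span {x}\<close>. The number
  \<open>t\<close> is the size of \<open>perp b l \<inter> C.span {z}\<close>.\<close>

lemma card_isotropic_lines_perp:
  fixes l
  assumes l: "l \<in> pg_lines smul"
  defines "q \<equiv> real CARD('k)" and "E \<equiv> real CARD('c)" and "s \<equiv> real (card (perp b l))"
  defines "t \<equiv> if l \<in> isotropic_lines then E else E / q"
  shows "real (card {k \<in> isotropic_lines. k \<subseteq> perp b l}) * (q\<^sup>2 - 1) * (q\<^sup>2 - q) * (q\<^sup>2 * E) =
    q\<^sup>2 * s * (s - 1 + (q\<^sup>2 - 1) * (t - 1)) - q ^ 3 * E * (s - 1)"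
proof -
  let ?S = "perp b l" and ?A = "\<lambda>x. {k \<in> isotropic_lines. x \<in> k \<and> k \<subseteq> perp b l}"
  have sl: "K.subspace l" and cl: "card l = CARD('k)\<^sup>2" using l by (auto simp: K.pg_lines_iff)
  have q: "q > 0" by (simp add: q_def)
  have S0: "0 \<in> ?S" and l0: "0 \<in> l" using K.subspace_perp sl K.subspace_0 by blast+
  have S: "CARD('v) = q\<^sup>2 * s"
    using K.card_perp[OF sl] cl by (simp add: q_def s_def mult.commute flip: of_nat_mult of_nat_power)
  have cnz: "real (card (W - {0})) = real (card W) - 1" if "0 \<in> W" for W :: "'v set"
  proof -
    have "card W > 0" using that by (auto simp: card_gt_0_iff)
    thus ?thesis using that by (simp add: of_nat_diff)
  qed
  \<comment> \<open>Apply \<open>card_perp_sum\<close> to \<open>l\<close> and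
    \<open>C.span {x}\<close>; the summand \<open>1\<close> accounts for the zero vector in their
    intersection.\<close>
  have A: "real (card (?A x)) * (q\<^sup>2 - q) * (q\<^sup>2 * E) =
      q\<^sup>2 * s * (1 + real (card {z \<in> l - {0}. z \<in> C.span {x}})) - q ^ 3 * E"
    if x: "x \<in> ?S - {0}" for x
  proof -
    have "card (?S \<inter> perp g {x}) * (CARD('k)\<^sup>2 * CARD('c)) = CARD('v) * card (l \<inter> C.span {x})"
      using card_perp_sum[OF sl subspace_restrict, of "C.span {x}"] cl C.card_span_singleton[of x] x
      by (simp add: perp_C_span)
    hence "real (card (?S \<inter> perp g {x})) * (q\<^sup>2 * E) = q\<^sup>2 * s * real (card (l \<inter> C.span {x}))"
      unfolding q_def E_def S[unfolded q_def, symmetric]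
      by (simp flip: of_nat_mult of_nat_power)
    moreover have "real (card (?A x)) * (q\<^sup>2 - q) = real (card (?S \<inter> perp g {x})) - q"
      using card_isotropic_lines_through[OF K.subspace_perp, of x l] x by (simp add: q_def)
    moreover have "{z \<in> l - {0}. z \<in> C.span {x}} = l \<inter> C.span {x} - {0}" by auto
    hence "real (card {z \<in> l - {0}. z \<in> C.span {x}}) = real (card (l \<inter> C.span {x})) - 1"
      using cnz[of "l \<inter> C.span {x}"] l0 C.span_zero by simp
    ultimately show ?thesis by (simp add: left_diff_distrib power2_eq_square power3_eq_cube)
  qed
  have B: "real (card {x \<in> ?S - {0}. z \<in> C.span {x}}) = t - 1" if z: "z \<in> l - {0}" for z
  proof -
    \<comment> \<open>Two nonzero vectors lie in each other's spans or in neither.\<close>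
    have "z \<in> C.span {x} \<longleftrightarrow> x \<in> C.span {z}" if "x \<noteq> 0" for x
      using z that C.span_singleton_eq[of z x] C.span_singleton_eq[of x z] C.span_superset[of "{x}"]
        C.span_superset[of "{z}"] by auto
    hence "{x \<in> ?S - {0}. z \<in> C.span {x}} = ?S \<inter> C.span {z} - {0}" by auto
    hence "real (card {x \<in> ?S - {0}. z \<in> C.span {x}}) = real (card (?S \<inter> C.span {z})) - 1"
      using cnz[of "?S \<inter> C.span {z}"] S0 C.span_zero by simp
    moreover have "real (card (?S \<inter> C.span {z})) = t"
      using card_perp_inter_point[OF l, of z] z q
      by (auto simp: t_def E_def q_def field_simps split: if_splits simp flip: of_nat_mult)
    ultimately show ?thesis by simp
  qed
  have "(\<Sum>k\<in>{k \<in> isotropic_lines. k \<subseteq> ?S}. real (card (k - {0}))) = (\<Sum>x\<in>?S - {0}. real (card (?A x)))"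
    using arg_cong[OF sum_card_nonzero_swap[of isotropic_lines ?S], of real] by simp
  moreover have "real (card (k - {0})) = q\<^sup>2 - 1" if "k \<in> isotropic_lines" for k
    using that cnz[of k] K.subspace_0[of k] by (simp add: isotropic_lines_def K.pg_lines_iff q_def)
  ultimately have "real (card {k \<in> isotropic_lines. k \<subseteq> ?S}) * (q\<^sup>2 - 1) = (\<Sum>x\<in>?S - {0}. real (card (?A x)))"
    by simp
  hence "real (card {k \<in> isotropic_lines. k \<subseteq> ?S}) * (q\<^sup>2 - 1) * (q\<^sup>2 - q) * (q\<^sup>2 * E) =
      (\<Sum>x\<in>?S - {0}. real (card (?A x)) * (q\<^sup>2 - q) * (q\<^sup>2 * E))"
    by (simp add: sum_distrib_right)
  also have "\<dots> = (\<Sum>x\<in>?S - {0}. q\<^sup>2 * s * (1 + real (card {z \<in> l - {0}. z \<in> C.span {x}})) - q ^ 3 * E)"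
    using A by (intro sum.cong) auto
  also have "\<dots> = q\<^sup>2 * s * ((s - 1) + (\<Sum>x\<in>?S - {0}. real (card {z \<in> l - {0}. z \<in> C.span {x}}))) - q ^ 3 * E * (s - 1)"
    by (simp only: sum_subtractf sum_distrib_left[symmetric] sum.distrib sum_constant cnz[OF S0] s_def)
      (simp add: algebra_simps)
  \<comment> \<open>The pairs with \<open>z \<in> C.span {x}\<close> are now summed over
    \<open>z\<close> first, where \<open>B\<close> gives a constant.\<close>
  also have "(\<Sum>x\<in>?S - {0}. real (card {z \<in> l - {0}. z \<in> C.span {x}})) =
      (\<Sum>z\<in>l - {0}. real (card {x \<in> ?S - {0}. z \<in> C.span {x}}))"
    using sum.swap_restrict[of "?S - {0}" "l - {0}" "\<lambda>_ _. 1::real" "\<lambda>x z. z \<in> C.span {x}"] by simp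
  also have "\<dots> = (\<Sum>z\<in>l - {0}. t - 1)" using B by (intro sum.cong) auto
  also have "\<dots> = (q\<^sup>2 - 1) * (t - 1)" by (simp add: cnz[OF l0] cl q_def)
  finally show ?thesis .
qed

text \<open>Since \<open>perp g {x}\<close> has \<open>N / E\<close> vectors, every nonzero
  \<open>x\<close> has degree \<open>(N / E - q) / (q ^ 2 - q)\<close>; \<open>large\<close> makes
  this positive.\<close>

lemma dual_of_symplectic_type_isotropic_lines:
  assumes d: "d \<ge> 1" and N: "CARD('v) = CARD('k) ^ (d + 3)" and large: "CARD('k) * CARD('c) < CARD('v)"
  obtains m where "dual_of_symplectic_type smul b d m isotropic_lines"
    "real m * ((real CARD('k))\<^sup>2 - real CARD('k)) * real CARD('c) =
      real CARD('v) - real CARD('k) * real CARD('c)"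
proof -
  define q E V where "q = real CARD('k)" "E = real CARD('c)" "V = real CARD('v)"
  note defs = this
  have q: "q \<ge> 2" using K.field_card_ge_2 unfolding defs by (metis of_nat_le_iff of_nat_numeral)
  have E: "E > 0" by (simp add: defs)
  have large': "q * E < V" using large unfolding defs by (metis of_nat_less_iff of_nat_mult)
  have qq: "q\<^sup>2 - q > 0" using q by (simp add: power2_eq_square)
  have deg: "real (card {k \<in> isotropic_lines. x \<in> k}) * (q\<^sup>2 - q) * E = V - q * E"
    if x: "x \<noteq> 0" for x
  proof -
    have "card (perp g {x}) * CARD('c) = CARD('v)"
      using K.card_perp[OF subspace_restrict, of "C.span {x}"] C.card_span_singleton[OF x]
      by (simp add: perp_C_span)
    hence "real (card (perp g {x})) * E = V" unfolding defs by (metis of_nat_mult)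
    moreover have "real (card {k \<in> isotropic_lines. x \<in> k}) * (q\<^sup>2 - q) = real (card (perp g {x})) - q"
      using card_isotropic_lines_through[of UNIV x] x by (simp add: defs)
    ultimately show ?thesis by (simp add: left_diff_distrib)
  qed
  have "(UNIV :: 'v set) \<noteq> {0}"
  proof
    assume "(UNIV :: 'v set) = {0}"
    hence "CARD('v) = card {0 :: 'v}" by (rule arg_cong)
    thus False using large by simp
  qed
  then obtain x0 :: 'v where x0: "x0 \<noteq> 0" by blast
  define m where "m = card {k \<in> isotropic_lines. x0 \<in> k}"
  have m: "real m * (q\<^sup>2 - q) * E = V - q * E" using deg[OF x0] by (simp add: m_def)
  hence "real m > 0" using large' qq E by (metis diff_gt_0_iff_gt zero_less_mult_pos2)
  moreover have "card {k \<in> isotropic_lines. x \<in> k} = m" if "x \<noteq> 0" for x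
  proof -
    have "real (card {k \<in> isotropic_lines. x \<in> k}) * (q\<^sup>2 - q) * E = real m * (q\<^sup>2 - q) * E"
      using deg[OF that] m by simp
    thus ?thesis using qq E by simp
  qed
  ultimately have cover: "m_cover smul b m isotropic_lines"
    using isotropic_lines_subset by (intro K.m_coverI) auto
  have "dual_of_symplectic_type smul b d m isotropic_lines"
  proof (rule K.dual_of_symplectic_typeI[OF d N cover], fold defs)
    fix l assume l: "l \<in> pg_lines smul"
    define s where "s = real (card (perp b l))"
    define t where "t = (if l \<in> isotropic_lines then E else E / q)"
    let ?X = "real (card {k \<in> isotropic_lines. k \<subseteq> perp b l})"
    have X: "?X * (q\<^sup>2 - 1) * (q\<^sup>2 - q) * (q\<^sup>2 * E) =
        q\<^sup>2 * s * (s - 1 + (q\<^sup>2 - 1) * (t - 1)) - q ^ 3 * E * (s - 1)"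
      using card_isotropic_lines_perp[OF l] by (simp only: defs s_def t_def)
    have "card (perp b l) * CARD('k)\<^sup>2 = CARD('v)"
      using K.card_perp[of l] l by (simp add: K.pg_lines_iff)
    hence V: "V = s * q\<^sup>2" unfolding defs s_def by (metis of_nat_mult of_nat_power)
    have V4: "V / q ^ 4 = s / q\<^sup>2" using q by (simp add: V field_simps power2_eq_square power4_eq_xxxx)
    have q1: "q\<^sup>2 - 1 \<noteq> 0" using qq q by linarith
    let ?i = "if l \<in> isotropic_lines then s / q\<^sup>2 else 0"
    \<comment> \<open>The required count is multiplied by its nonzero common denominator, so that
      \<open>m\<close> and \<open>X\<close> can be substituted.\<close>
    have "(real m * (s / q\<^sup>2 - 1) / (q\<^sup>2 - 1) + ?i) * ((q\<^sup>2 - 1) * (q\<^sup>2 - q) * (q\<^sup>2 * E)) =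
        (real m * (q\<^sup>2 - q) * E) * ((s / q\<^sup>2 - 1) * q\<^sup>2) + ?i * q\<^sup>2 * ((q\<^sup>2 - 1) * (q\<^sup>2 - q) * E)"
      using q1 by (simp add: distrib_right)
    also have "(s / q\<^sup>2 - 1) * q\<^sup>2 = s - q\<^sup>2" using q by (simp add: left_diff_distrib)
    also have "?i * q\<^sup>2 = (if l \<in> isotropic_lines then s else 0)" using q by simp
    also have "real m * (q\<^sup>2 - q) * E * (s - q\<^sup>2) +
        (if l \<in> isotropic_lines then s else 0) * ((q\<^sup>2 - 1) * (q\<^sup>2 - q) * E) =
        q\<^sup>2 * s * (s - 1 + (q\<^sup>2 - 1) * (t - 1)) - q ^ 3 * E * (s - 1)"
    proof (cases "l \<in> isotropic_lines")
      case True
      show ?thesis unfolding m V t_def using True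
        by (simp add: algebra_simps power2_eq_square power3_eq_cube)
    next
      case False
      \<comment> \<open>Eliminating \<open>E\<close> in favour of \<open>t\<close> leaves a
        polynomial identity.\<close>
      have "E = t * q" using False q by (simp add: t_def)
      thus ?thesis unfolding m V using False
        by (simp add: algebra_simps power2_eq_square power3_eq_cube)
    qed
    also have "\<dots> = ?X * ((q\<^sup>2 - 1) * (q\<^sup>2 - q) * (q\<^sup>2 * E))" using X by (simp add: mult.assoc)
    finally show "?X = real m * (V / q ^ 4 - 1) / (q\<^sup>2 - 1) +
        (if l \<in> isotropic_lines then V / q ^ 4 else 0)"
      unfolding V4 using q1 qq q E by simp
  qed
  thus ?thesis using that m unfolding defs by blast
qed

lemma perp_restrict_span: "perp g (K.span S) = perp g S"
proof
  have "S \<subseteq> perp g (perp g S)" by (rule C.subset_perp_commute[THEN iffD1]) simp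
  hence "K.span S \<subseteq> perp g (perp g S)"
    by (rule K.span_minimal[OF _ subspace_restrict[OF C.subspace_perp]])
  thus "perp g S \<subseteq> perp g (K.span S)" by (rule C.subset_perp_commute[THEN iffD1])
qed (use K.span_superset[of S] in \<open>auto simp: perp_def\<close>)

text \<open>A spread member is the \<open>'c\<close>-span of some \<open>x\<close>, and by
  \<open>perp_C_span\<close> the forms \<open>b\<close> and \<open>g\<close> give it the same
  orthogonality relations.\<close>

lemma spread_member_subset_perp_iff:
  assumes "s \<in> pg_points sc"
  shows "s \<subseteq> perp b l \<longleftrightarrow> s \<subseteq> perp g l"
proof -
  obtain x where x: "x \<noteq> 0" "s = C.span {x}" using assms unfolding C.pg_points_iff by blast
  have "s \<subseteq> perp b l \<longleftrightarrow> l \<subseteq> perp g {x}"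
    unfolding perp_C_span[symmetric] x(2) by (rule K.subset_perp_commute)
  also have "\<dots> \<longleftrightarrow> x \<in> perp g l" using C.subset_perp_commute[of l "{x}"] by simp
  also have "\<dots> \<longleftrightarrow> s \<subseteq> perp g l"
    unfolding x(2) by (rule C.point_subset_iff[OF C.subspace_perp, symmetric])
  finally show ?thesis .
qed

lemma spread_member_eq_span:
  assumes "s \<in> pg_points sc" "x \<in> s" "x \<noteq> 0"
  shows "s = C.span {x}"
  using assms C.span_singleton_eq unfolding C.pg_points_iff by blast

lemma spread_members_through:
  assumes "x \<noteq> 0" shows "{s \<in> pg_points sc. x \<in> s} = {C.span {x}}"
  using spread_member_eq_span assms C.pg_points_iff C.span_base[of x "{x}"] by blast

text \<open>The space \<open>perp g l\<close> is a \<open>'c\<close>-subspace, so the spread members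
  inside it partition its nonzero vectors.\<close>

lemma card_spread_perp:
  "card {s \<in> pg_points sc. s \<subseteq> perp b l} * (CARD('c) - 1) = card (perp g l) - 1"
proof -
  let ?W = "perp g l"
  have "(\<Sum>s\<in>{s \<in> pg_points sc. s \<subseteq> ?W}. card (s - {0})) =
      (\<Sum>x\<in>?W - {0}. card {s \<in> pg_points sc. x \<in> s \<and> s \<subseteq> ?W})"
    by (rule sum_card_nonzero_swap)
  also have "\<dots> = (\<Sum>x\<in>?W - {0}. 1)"
  proof (intro sum.cong refl)
    fix x assume x: "x \<in> ?W - {0}"
    hence "{s \<in> pg_points sc. x \<in> s \<and> s \<subseteq> ?W} = {s \<in> pg_points sc. x \<in> s}"
      using spread_members_through[of x] C.point_subset_iff[OF C.subspace_perp, of x l] by blast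
    thus "card {s \<in> pg_points sc. x \<in> s \<and> s \<subseteq> ?W} = 1"
      using spread_members_through[of x] x by simp
  qed
  also have "\<dots> = card ?W - 1" using C.subspace_0[OF C.subspace_perp, of l] by simp
  also have "(\<Sum>s\<in>{s \<in> pg_points sc. s \<subseteq> ?W}. card (s - {0})) =
      (\<Sum>s\<in>{s \<in> pg_points sc. s \<subseteq> ?W}. CARD('c) - 1)"
  proof (intro sum.cong refl)
    fix s assume "s \<in> {s \<in> pg_points sc. s \<subseteq> ?W}"
    then obtain x where "x \<noteq> 0" "s = C.span {x}" unfolding C.pg_points_iff by blast
    thus "card (s - {0}) = CARD('c) - 1" using C.card_span_singleton[of x] C.span_zero by simp
  qed
  finally have "card {s \<in> pg_points sc. s \<subseteq> ?W} * (CARD('c) - 1) = card ?W - 1" by simp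
  moreover have "{s \<in> pg_points sc. s \<subseteq> perp b l} = {s \<in> pg_points sc. s \<subseteq> ?W}"
    using spread_member_subset_perp_iff by blast
  ultimately show ?thesis by (simp only:)
qed

end

section \<open>The spread and the two orbits for a quadratic extension\<close>

locale quadratic_trace_geometry = trace_geometry smul b sc g j tr
  for smul :: "'k::{field,finite} \<Rightarrow> 'v::{ab_group_add,finite} \<Rightarrow> 'v" and b
    and sc :: "'c::{field,finite} \<Rightarrow> 'v \<Rightarrow> 'v" and g j tr +
  assumes card_quadratic: "CARD('c) = CARD('k)\<^sup>2"
begin

lemma spread_subset_isotropic_lines: "pg_points sc \<subseteq> isotropic_lines"
proof
  fix s assume "s \<in> pg_points sc"
  then obtain x where x: "x \<noteq> 0" "s = C.span {x}" unfolding C.pg_points_iff by blast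
  have s: "s \<in> pg_lines smul"
    using C.card_span_singleton[OF x(1)] subspace_restrict[OF C.subspace_span]
    by (simp add: K.pg_lines_iff x(2) card_quadratic)
  have "perp g {x} = perp g s" unfolding x(2) by (rule C.perp_span[symmetric])
  moreover have "s \<subseteq> perp g {x}"
    unfolding x(2) C.point_subset_iff[OF C.subspace_perp] by (simp add: perp_def)
  ultimately show "s \<in> isotropic_lines" using s by (simp add: isotropic_lines_def)
qed

text \<open>If \<open>x\<close> and \<open>y\<close> span \<open>l\<close>, then
  \<open>perp g l\<close> is the \<open>b\<close>-perp of \<open>C.span {x} + C.span {y}\<close>.
  The two summands coincide if \<open>l\<close> is in the spread and meet trivially
  otherwise.\<close>

lemma card_perp_line:
  assumes l: "l \<in> pg_lines smul"
  shows "card (perp g l) * (if l \<in> pg_points sc then CARD('c) else CARD('c)\<^sup>2) = CARD('v)"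
proof -
  obtain x where x: "x \<in> l" "x \<noteq> 0" using K.pg_line_nonzero_vector[OF l] .
  obtain y where y: "y \<in> l" "y \<notin> K.span {x}" "l = K.span {x, y}"
    using K.pg_line_other_point[OF l x] by blast
  have "y \<noteq> 0" using y(2) K.span_zero by auto
  have perp: "perp g l = perp b (C.span {x}) \<inter> perp b (C.span {y})"
    unfolding perp_C_span unfolding y(3) perp_restrict_span by (auto simp: perp_def)
  have card: "card (perp g l) * (CARD('c) * CARD('c)) = CARD('v) * card (C.span {x} \<inter> C.span {y})"
    using card_perp_sum[OF subspace_restrict subspace_restrict, OF C.subspace_span C.subspace_span, of "{x}" "{y}"]
    unfolding C.card_span_singleton[OF x(2)] C.card_span_singleton[OF \<open>y \<noteq> 0\<close>] perp .
  have pos: "CARD('c) > 0" by simp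
  show ?thesis
  proof (cases "l \<in> pg_points sc")
    case True
    hence "C.span {x} = l" "C.span {y} = l"
      using spread_member_eq_span x y(1) \<open>y \<noteq> 0\<close> by blast+
    hence "card (C.span {x} \<inter> C.span {y}) = CARD('c)"
      using C.card_span_singleton[OF x(2)] by simp
    thus ?thesis using card True pos by (simp add: mult.assoc[symmetric])
  next
    case False
    \<comment> \<open>A common nonzero vector would make both spans equal; having as many vectors as
      \<open>l\<close>, this span would be \<open>l\<close> itself.\<close>
    have "C.span {x} \<inter> C.span {y} \<subseteq> {0}"
    proof (rule ccontr)
      assume "\<not> ?thesis"
      then obtain z where "z \<in> C.span {x}" "z \<in> C.span {y}" "z \<noteq> 0" by blast
      hence "C.span {y} = C.span {x}" using C.span_singleton_eq by metis
      hence "{x, y} \<subseteq> C.span {x}" using C.span_base[of x "{x}"] C.span_base[of y "{y}"] by auto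
      hence "l \<subseteq> C.span {x}"
        unfolding y(3) by (rule K.span_minimal[OF _ subspace_restrict[OF C.subspace_span]])
      moreover have "card (C.span {x}) = card l"
        using l C.card_span_singleton[OF x(2)] by (simp add: K.pg_lines_iff card_quadratic)
      ultimately have "l = C.span {x}" by (intro card_subset_eq) simp_all
      thus False using False x(2) C.pg_points_iff by blast
    qed
    hence "C.span {x} \<inter> C.span {y} = {0}" using C.span_zero by blast
    thus ?thesis using card False by (simp add: power2_eq_square)
  qed
qed

text \<open>The count is \<open>(card (perp g l) - 1) / (q ^ 2 - 1)\<close>. Passing from
  \<open>N / q ^ 4\<close> to \<open>N / q ^ 2\<close> vectors raises it by exactly
  \<open>N / q ^ 4\<close>.\<close>

lemma dual_of_symplectic_type_spread:
  assumes d: "d \<ge> 1" and N: "CARD('v) = CARD('k) ^ (d + 3)"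
  shows "dual_of_symplectic_type smul b d 1 (pg_points sc)"
proof (rule K.dual_of_symplectic_typeI[OF d N])
  show "m_cover smul b 1 (pg_points sc)"
    using spread_subset_isotropic_lines isotropic_lines_subset spread_members_through
    by (intro K.m_coverI) auto
next
  fix l assume l: "l \<in> pg_lines smul"
  define q V where "q = real CARD('k)" "V = real CARD('v)"
  note defs = this
  let ?c = "real (card {s \<in> pg_points sc. s \<subseteq> perp b l})"
  have q: "q \<ge> 2" using K.field_card_ge_2 unfolding defs by (metis of_nat_le_iff of_nat_numeral)
  have q1: "q\<^sup>2 - 1 > 0" using q power_mono[of 2 q 2] by simp
  have "card (perp g l) \<ge> 1"
    using C.subspace_0[OF C.subspace_perp, of l] by (simp add: Suc_le_eq card_gt_0_iff) blast
  hence "real (card {s \<in> pg_points sc. s \<subseteq> perp b l} * (CARD('c) - 1)) = real (card (perp g l)) - 1"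
    unfolding card_spread_perp by (simp add: of_nat_diff)
  hence c: "?c * (q\<^sup>2 - 1) = real (card (perp g l)) - 1"
    using card_quadratic by (simp add: of_nat_diff defs)
  have "real (card (perp g l)) * (if l \<in> pg_points sc then q\<^sup>2 else q ^ 4) = V"
    using card_perp_line[OF l, THEN arg_cong[where f = real]]
    by (auto simp: card_quadratic defs split: if_splits)
  hence p: "real (card (perp g l)) = V / (if l \<in> pg_points sc then q\<^sup>2 else q ^ 4)"
    using q by (auto simp: field_simps)
  have "?c = (real (card (perp g l)) - 1) / (q\<^sup>2 - 1)" using c q1 by (simp add: field_simps)
  also have "\<dots> = real 1 * (V / q ^ 4 - 1) / (q\<^sup>2 - 1) +
      (if l \<in> pg_points sc then V / q ^ 4 else 0)"
  proof (cases "l \<in> pg_points sc")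
    case True
    have "V / q\<^sup>2 = V / q ^ 4 * q\<^sup>2" using q by (simp add: power2_eq_square power4_eq_xxxx)
    hence "V / q\<^sup>2 - 1 = (V / q ^ 4 - 1) + V / q ^ 4 * (q\<^sup>2 - 1)"
      by (simp only: right_diff_distrib)
    hence "(V / q\<^sup>2 - 1) / (q\<^sup>2 - 1) = (V / q ^ 4 - 1) / (q\<^sup>2 - 1) + V / q ^ 4"
      using q1 by (simp only: add_divide_distrib) simp
    thus ?thesis using True p by (simp only: if_True of_nat_1 mult_1)
  qed (use p in simp)
  finally show "?c = real 1 * (real CARD('v) / real CARD('k) ^ 4 - 1) / ((real CARD('k))\<^sup>2 - 1) +
      (if l \<in> pg_points sc then real CARD('v) / real CARD('k) ^ 4 else 0)"
    by (simp only: defs)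
qed

text \<open>For \<open>s\<close> spanned by a common nonzero vector \<open>x\<close>, conjugacy
  means \<open>l \<subseteq> perp g {x}\<close>, and testing at one vector decides isotropy. The
  answer is therefore the same for all spread members that \<open>l\<close> meets.\<close>

lemma conjugate_spread_member_iff:
  assumes l: "l \<in> pg_lines smul" and s: "s \<in> pg_points sc" "l \<inter> s \<noteq> {0}"
  shows "conjugate b l s \<longleftrightarrow> l \<in> isotropic_lines"
proof -
  have "0 \<in> l \<inter> s"
    using K.subspace_0[OF K.subspace_pg_line[OF l]] s(1) C.span_zero unfolding C.pg_points_iff by blast
  then obtain x where x: "x \<in> l" "x \<in> s" "x \<noteq> 0" using s(2) by blast
  have "conjugate b l s \<longleftrightarrow> l \<subseteq> perp g {x}"
    unfolding conjugate_def spread_member_eq_span[OF s(1) x(2,3)] perp_C_span ..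
  thus ?thesis using isotropic_iff_perp_point[OF l x(1,3)] l by (simp add: isotropic_lines_def)
qed

text \<open>This keeps the quantifiers over spread members in the two orbits from being
  vacuous.\<close>

lemma ex_spread_member_meeting:
  assumes l: "l \<in> pg_lines smul"
  obtains s where "s \<in> pg_points sc" "l \<inter> s \<noteq> {0}"
proof -
  obtain x where x: "x \<in> l" "x \<noteq> 0" using K.pg_line_nonzero_vector[OF l] .
  hence "C.span {x} \<in> pg_points sc" "l \<inter> C.span {x} \<noteq> {0}"
    using C.pg_points_iff C.span_base[of x "{x}"] by blast+
  thus ?thesis by (rule that)
qed

text \<open>This is \<open>O1 = T - U\<close>.\<close>

lemma nowhere_conjugate_lines_eq:
  "{l \<in> polar_lines smul b. l \<notin> pg_points sc \<and>
     (\<forall>s\<in>pg_points sc. l \<inter> s \<noteq> {0} \<longrightarrow> \<not> conjugate b l s)} = polar_lines smul b - isotropic_lines"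
proof -
  have "(l \<notin> pg_points sc \<and> (\<forall>s\<in>pg_points sc. l \<inter> s \<noteq> {0} \<longrightarrow> \<not> conjugate b l s)) \<longleftrightarrow>
      l \<notin> isotropic_lines" if "l \<in> polar_lines smul b" for l
  proof -
    have l: "l \<in> pg_lines smul" using that by (simp add: polar_lines_def)
    obtain s where s: "s \<in> pg_points sc" "l \<inter> s \<noteq> {0}"
      using ex_spread_member_meeting[OF l] .
    show ?thesis
    proof
      assume "l \<notin> pg_points sc \<and> (\<forall>s\<in>pg_points sc. l \<inter> s \<noteq> {0} \<longrightarrow> \<not> conjugate b l s)"
      thus "l \<notin> isotropic_lines" using conjugate_spread_member_iff[OF l s] s by blast
    next
      assume "l \<notin> isotropic_lines"
      thus "l \<notin> pg_points sc \<and> (\<forall>s\<in>pg_points sc. l \<inter> s \<noteq> {0} \<longrightarrow> \<not> conjugate b l s)"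
        using conjugate_spread_member_iff[OF l] spread_subset_isotropic_lines by auto
    qed
  qed
  thus ?thesis by blast
qed

text \<open>This is \<open>O2 = U - F\<close>.\<close>

lemma everywhere_conjugate_lines_eq:
  "{l \<in> polar_lines smul b. l \<notin> pg_points sc \<and>
     (\<forall>s\<in>pg_points sc. l \<inter> s \<noteq> {0} \<longrightarrow> conjugate b l s)} = isotropic_lines - pg_points sc"
proof -
  have "(\<forall>s\<in>pg_points sc. l \<inter> s \<noteq> {0} \<longrightarrow> conjugate b l s) \<longleftrightarrow> l \<in> isotropic_lines"
    if "l \<in> polar_lines smul b" for l
  proof -
    have l: "l \<in> pg_lines smul" using that by (simp add: polar_lines_def)
    obtain s where s: "s \<in> pg_points sc" "l \<inter> s \<noteq> {0}"
      using ex_spread_member_meeting[OF l] .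
    show ?thesis
    proof
      assume "\<forall>s\<in>pg_points sc. l \<inter> s \<noteq> {0} \<longrightarrow> conjugate b l s"
      thus "l \<in> isotropic_lines" using conjugate_spread_member_iff[OF l s] s by blast
    qed (use conjugate_spread_member_iff[OF l] in simp)
  qed
  thus ?thesis using isotropic_lines_subset by blast
qed

text \<open>The nested covers \<open>F\<close>, \<open>U\<close>, \<open>T\<close> have degrees
  \<open>1 < mU < mT\<close>; strictness makes the degrees of the differences positive.\<close>

lemma dual_of_symplectic_type_orbits:
  assumes d: "d \<ge> 2" and N: "CARD('v) = CARD('k) ^ (d + 3)"
    and L: "L \<in> {pg_points sc, polar_lines smul b - isotropic_lines, isotropic_lines - pg_points sc}"
  shows "\<exists>m. dual_of_symplectic_type smul b d m L"
proof -
  \<comment> \<open>With \<open>g = b\<close> and the identity as trace map the general count covers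
    the polar lines of \<open>b\<close>.\<close>
  interpret T: trace_geometry smul b smul b id id
    by unfold_locales (auto intro: exI[of _ 1])
  have T: "T.isotropic_lines = polar_lines smul b"
    by (simp add: T.isotropic_lines_def polar_lines_def)
  define q V where "q = real CARD('k)" "V = real CARD('v)"
  note defs = this
  have d1: "d \<ge> 1" using d by simp
  have k: "CARD('k) > 1" using K.field_card_ge_2 by simp
  have q: "q > 1" using k by (simp add: defs)
  have V: "V = q ^ (d + 3)" by (simp add: defs N)
  have large: "CARD('k) * CARD('k) < CARD('v)" "CARD('k) * CARD('c) < CARD('v)"
    using power_strict_increasing[of 2 "d + 3" "CARD('k)"] power_strict_increasing[of 3 "d + 3" "CARD('k)"] k d
    by (simp_all add: N card_quadratic power2_eq_square power3_eq_cube)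
  obtain mT where mT: "dual_of_symplectic_type smul b d mT (polar_lines smul b)"
      "real mT * (q\<^sup>2 - q) * q = V - q * q"
    using T.dual_of_symplectic_type_isotropic_lines[OF d1 N large(1)] unfolding T defs by blast
  obtain mU where mU: "dual_of_symplectic_type smul b d mU isotropic_lines"
      "real mU * (q\<^sup>2 - q) * q\<^sup>2 = V - q * q\<^sup>2"
    using dual_of_symplectic_type_isotropic_lines[OF d1 N large(2)]
    unfolding card_quadratic defs of_nat_power by blast
  have qq: "(q\<^sup>2 - q) * q\<^sup>2 > 0" using q by (simp add: power2_eq_square)
  have "real mU < real mT"
  proof -
    \<comment> \<open>Both degree equations are brought to the factor
      \<open>(q ^ 2 - q) * q ^ 2\<close>; their right sides then differ by
      \<open>V * (q - 1)\<close>.\<close>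
    have "real mT * ((q\<^sup>2 - q) * q\<^sup>2) = (real mT * (q\<^sup>2 - q) * q) * q"
      by (simp add: power2_eq_square)
    also have "\<dots> = (V - q * q) * q" by (simp only: mT(2))
    also have "\<dots> - real mU * ((q\<^sup>2 - q) * q\<^sup>2) = V * (q - 1)"
      using mU(2) by (simp add: power2_eq_square algebra_simps)
    finally have "(real mT - real mU) * ((q\<^sup>2 - q) * q\<^sup>2) = V * (q - 1)"
      by (simp only: left_diff_distrib)
    moreover have "V * (q - 1) > 0" using q V by simp
    ultimately have "(real mT - real mU) * ((q\<^sup>2 - q) * q\<^sup>2) > 0" by simp
    thus ?thesis using qq by (simp add: zero_less_mult_iff)
  qed
  hence TU: "mU < mT" by simp
  have "1 < mU"
  proof -
    \<comment> \<open>Since \<open>(q ^ 2 - q) * q ^ 2 = q ^ 4 - q ^ 3\<close>, degree 1 would mean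
      \<open>V = q ^ 4\<close>; here \<open>d \<ge> 2\<close> gives more.\<close>
    have "q ^ 4 < V" unfolding V using q d by (intro power_strict_increasing) auto
    hence "1 * ((q\<^sup>2 - q) * q\<^sup>2) < real mU * ((q\<^sup>2 - q) * q\<^sup>2)"
      using mU(2) by (simp add: algebra_simps power2_eq_square power4_eq_xxxx)
    hence "1 < real mU" using qq mult_less_cancel_right_pos by blast
    thus ?thesis by simp
  qed
  note F = dual_of_symplectic_type_spread[OF d1 N]
  show ?thesis
    using L F dual_of_symplectic_type_diff[OF mT(1) mU(1) isotropic_lines_subset TU]
      dual_of_symplectic_type_diff[OF mU(1) F spread_subset_isotropic_lines \<open>1 < mU\<close>] by blast
qed

end

section \<open>Specialisation to the trace form of a field embedding\<close>

theorem corollary3p10: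
  fixes n q :: nat
    and h :: "'k::finite_field \<Rightarrow> 'a::finite_field"
    and f :: "'a ^ 'n::finite \<Rightarrow> 'a ^ 'n \<Rightarrow> 'a"
    and c :: 'a
  assumes "n \<ge> 2"
    and "primepow q"
    and "CARD('k) = q" and "CARD('a) = q ^ 2" and "CARD('n) = 2 * n"
    and "field_embedding h"
    and "symplectic_form (*s) f"
    and "c \<noteq> 0"
  shows "\<forall>L \<in> {dye_spread, orbit_O1 h f c, orbit_O2 h f c}.
           \<exists>m. dual_of_symplectic_type (restrict_scale h) (trace_form h f c) (4 * n - 3) m L"
proof -
  have pk: "primepow CARD('k)" and ak: "CARD('a) = CARD('k)\<^sup>2" using assms by simp_all
  note h = \<open>field_embedding h\<close>
  have sym: "symplectic_form (restrict_scale h) (trace_form h f c)"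
    by (rule symplectic_trace_form[OF h pk ak]) (use assms in auto)
  interpret finite_space "restrict_scale h :: 'k \<Rightarrow> 'a ^ 'n \<Rightarrow> 'a ^ 'n"
    unfolding finite_space_def by (rule vector_space_restrict_scale[OF h])
  have tr0: "ftrace h 0 = 0"
    using field_trace[OF h pk ak, of 0] field_embedding_0[OF h] injD[OF field_embedding_inj[OF h]]
    by (metis add.right_neutral power_0_left zero_less_card_finite not_less0)
  \<comment> \<open>The scalar \<open>c\<close> is absorbed into the trace map, so that
    \<open>trace_form h f c\<close> is this map composed with \<open>f\<close>.\<close>
  interpret quadratic_trace_geometry "restrict_scale h :: 'k \<Rightarrow> 'a ^ 'n \<Rightarrow> 'a ^ 'n" "trace_form h f c"
    "(*s)" f h "\<lambda>u. ftrace h (c * u)"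
  proof unfold_locales
    fix u :: 'a assume "u \<noteq> 0"
    obtain t where "ftrace h t \<noteq> 0" using field_trace_nonzero[OF h pk ak] by blast
    \<comment> \<open>The factor \<open>t / (c * u)\<close> turns the argument into
      \<open>t\<close>, whose trace is nonzero.\<close>
    hence "ftrace h (c * (t / (c * u) * u)) \<noteq> 0" using \<open>u \<noteq> 0\<close> \<open>c \<noteq> 0\<close> by simp
    thus "\<exists>a. ftrace h (c * (a * u)) \<noteq> 0" by blast
  qed (use assms sym tr0 ak in \<open>auto simp: restrict_scale_def trace_form_def\<close>)
  have F: "dye_spread = pg_points ((*s) :: 'a \<Rightarrow> 'a ^ 'n \<Rightarrow> 'a ^ 'n)"
    by (simp add: dye_spread_def pg_points_def)
  \<comment> \<open>A space of dimension \<open>2 * n\<close> over the field of order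
    \<open>q ^ 2\<close> has \<open>q ^ (4 * n)\<close> vectors.\<close>
  have "CARD('a ^ 'n) = CARD('k) ^ (4 * n)"
    using assms by (simp flip: power_mult)
  moreover have "4 * n = (4 * n - 3) + 3" using \<open>n \<ge> 2\<close> by simp
  ultimately have N: "CARD('a ^ 'n) = CARD('k) ^ ((4 * n - 3) + 3)" by simp
  show ?thesis
    unfolding orbit_O1_def orbit_O2_def F nowhere_conjugate_lines_eq everywhere_conjugate_lines_eq
    using dual_of_symplectic_type_orbits[OF _ N] \<open>n \<ge> 2\<close> by simp
qed

end
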